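(* Let $R$ be a commutative ring with unit, let $\mathcal{A}$ be a set (alphabet), and let $L$ be a stable set of words in the alphabet $\mathcal{A}$. Let $\mathcal{P}$ be the algebra of phrases formed by non-empty words in the alphabet $\mathcal{A}$, and let $\Delta=\Delta_L:\mathcal{P}\to\mathcal{P}\otimes\mathcal{P}$ be the unique algebra homomorphism such that for every non-empty word $w$, $$\Delta(w)=w\otimes 1+\sum_{c} l_c(w)\otimes r_c(w),$$ where $c$ runs over all cuts of $w$ (including the empty cut). Then the bialgebra $(\mathcal{P},\Delta)$ is a Hopf algebra (i.e., it has a counit and an antipode).
   Context: All tensor products are over $R$. Words. A word of length $m\ge 0$ is a finite sequence $w=w(1)\cdots w(m)$ of elements of $\mathcal{A}$; concatenation is denoted $wx$. For a word $w$ of length $m\ge1$ and $1\le i\le j\le m+1$, $w_{i,j}=w(i)w(i+1)\cdots w(j-1)$ (empty iff $i=j$). A set $L$ of non-empty words is stable if for any word $w$ of length $m\ge1$ and any $1\le i<j\le m+1$ with $(i,j)\ne(1,m+1)$ and $w_{i,j}\in L$, one has $w\in L$ if and only if $w_{1,i}w_{j,m+1}\in L$. Phrases. A phrase of length $k\ge0$ is a finite sequence $(w_1|w_2|\cdots|w_k)$ of $k$ words; the empty phrase ($k=0$) is denoted $1$. $\mathcal{P}$ is the free $R$-module with basis the phrases all of whose words are non-empty (including $1$), with multiplication given by concatenation of phrases, $(w_1|\cdots|w_k)(x_1|\cdots|x_t)=(w_1|\cdots|w_k|x_1|\cdots|x_t)$; it is an associative algebra with unit $1$. A word $w$ is identified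 with the one-word phrase $(w)$. Multiplication in $\mathcal{P}\otimes\mathcal{P}$ is $(a\otimes a')(b\otimes b')=ab\otimes a'b'$. Cuts. Let $w$ be a word of length $m\ge1$. A cut of $w$ of length $k\ge0$ is a sequence $c=(i_1,j_1,\ldots,i_k,j_k)$ of $2k$ integers with $1\le i_1<j_1<i_2<j_2<\cdots<i_k<j_k\le m+1$ such that the words $w_{i_1,j_1},\ldots,w_{i_k,j_k}$ all belong to $L$; for $k=1$ one additionally requires $(i_1,j_1)\ne(1,m+1)$. There is a unique cut of length $0$, the empty cut. For a cut $c$ set $l_c(w)=(w_{i_1,j_1}|w_{i_2,j_2}|\cdots|w_{i_k,j_k})\in\mathcal{P}$ and let $r_c(w)$ be the word $w_{1,i_1}w_{j_1,i_2}w_{j_2,i_3}\cdots w_{j_{k-1},i_k}w_{j_k,m+1}$. For the empty cut, $l_c(w)=1$ and $r_c(w)=w$. A bialgebra here is an associative unital $R$-algebra with a coassociative comultiplication that is a unital algebra homomorphism (a counit is not part of the definition). *)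

theory Defs
  imports Main "HOL-Library.Poly_Mapping"
begin

section \<open>Modules over a commutative ring with unit\<close>

text \<open>
  The base ring is a type of sort \<open>{comm_ring, comm_monoid_mult}\<close>. This is the class
  \<open>comm_ring_1\<close> without the axiom \<open>0 \<noteq> 1\<close>, so the zero ring is admitted. Modules are carrier
  sets in an additive group, with an explicit scalar multiplication.
\<close>

definition linear_on ::
  "'m set \<Rightarrow> ('r::{comm_ring,comm_monoid_mult} \<Rightarrow> 'm \<Rightarrow> 'm) \<Rightarrow>
   'n set \<Rightarrow> ('r \<Rightarrow> 'n \<Rightarrow> 'n) \<Rightarrow> ('m::ab_group_add \<Rightarrow> 'n::ab_group_add) \<Rightarrow> bool"
  where "linear_on M s N t f \<longleftrightarrow>
    (\<forall>x\<in>M. f x \<in> N) \<and>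
    (\<forall>x\<in>M. \<forall>y\<in>M. f (x + y) = f x + f y) \<and>
    (\<forall>c. \<forall>x\<in>M. f (s c x) = t c (f x))"

definition bilinear_on ::
  "'m set \<Rightarrow> ('r::{comm_ring,comm_monoid_mult} \<Rightarrow> 'm \<Rightarrow> 'm) \<Rightarrow>
   'n set \<Rightarrow> ('r \<Rightarrow> 'n \<Rightarrow> 'n) \<Rightarrow> 'k set \<Rightarrow> ('r \<Rightarrow> 'k \<Rightarrow> 'k) \<Rightarrow>
   ('m::ab_group_add \<Rightarrow> 'n::ab_group_add \<Rightarrow> 'k::ab_group_add) \<Rightarrow> bool"
  where "bilinear_on M s N t K u f \<longleftrightarrow>
    (\<forall>x\<in>M. linear_on N t K u (f x)) \<and> (\<forall>y\<in>N. linear_on M s K u (\<lambda>x. f x y))"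

definition module_scale ::
  "('r::{comm_ring,comm_monoid_mult} \<Rightarrow> 'm \<Rightarrow> 'm::ab_group_add) \<Rightarrow> bool"
  where "module_scale s \<longleftrightarrow>
    (\<forall>a x y. s a (x + y) = s a x + s a y) \<and> (\<forall>a b x. s (a + b) x = s a x + s b x) \<and>
    (\<forall>a b x. s (a * b) x = s a (s b x)) \<and> (\<forall>x. s 1 x = x)"

subsection \<open>Free modules\<close>

definition free_module :: "'b set \<Rightarrow> ('b \<Rightarrow>\<^sub>0 'r::zero) set"
  where "free_module B = {p. Poly_Mapping.keys p \<subseteq> B}"

definition basis :: "'b \<Rightarrow> 'b \<Rightarrow>\<^sub>0 'r::{comm_ring,comm_monoid_mult}"
  where "basis x = Poly_Mapping.single x 1"

definition scale :: "'r \<Rightarrow> ('b \<Rightarrow>\<^sub>0 'r) \<Rightarrow> 'b \<Rightarrow>\<^sub>0 'r::{comm_ring,comm_monoid_mult}"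
  where "scale c p = Poly_Mapping.map (\<lambda>a. c * a) p"

text \<open>The linear extension of a function given on the basis, and its bilinear analogue.\<close>

definition lin_ext ::
  "('r::{comm_ring,comm_monoid_mult} \<Rightarrow> 'm \<Rightarrow> 'm) \<Rightarrow> ('b \<Rightarrow> 'm::ab_group_add) \<Rightarrow>
   ('b \<Rightarrow>\<^sub>0 'r) \<Rightarrow> 'm"
  where "lin_ext s f p = (\<Sum>x\<in>Poly_Mapping.keys p. s (Poly_Mapping.lookup p x) (f x))"

definition bilin_ext ::
  "('b \<Rightarrow> 'c \<Rightarrow> 'd \<Rightarrow>\<^sub>0 'r) \<Rightarrow> ('b \<Rightarrow>\<^sub>0 'r::{comm_ring,comm_monoid_mult}) \<Rightarrow>
   ('c \<Rightarrow>\<^sub>0 'r) \<Rightarrow> 'd \<Rightarrow>\<^sub>0 'r"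
  where "bilin_ext f p q = lin_ext scale (\<lambda>x. lin_ext scale (f x) q) p"

subsection \<open>Tensor products of free modules\<close>

text \<open>
  The tensor product of the free modules on \<open>B\<close> and \<open>C\<close> is realised as the free module on
  \<open>B \<times> C\<close>; the lemmas \<open>tensor_bilinear\<close> and \<open>tensor_universal\<close> below show that it has
  the defining universal property.
\<close>

definition tensor ::
  "('b \<Rightarrow>\<^sub>0 'r::{comm_ring,comm_monoid_mult}) \<Rightarrow> ('c \<Rightarrow>\<^sub>0 'r) \<Rightarrow> ('b \<times> 'c \<Rightarrow>\<^sub>0 'r)"
  where "tensor = bilin_ext (\<lambda>x y. basis (x, y))"

definition tensor_map ::
  "(('b \<Rightarrow>\<^sub>0 'r) \<Rightarrow> 'd \<Rightarrow>\<^sub>0 'r) \<Rightarrow> (('c \<Rightarrow>\<^sub>0 'r) \<Rightarrow> 'e \<Rightarrow>\<^sub>0 'r) \<Rightarrow>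
   ('b \<times> 'c \<Rightarrow>\<^sub>0 'r::{comm_ring,comm_monoid_mult}) \<Rightarrow> ('d \<times> 'e \<Rightarrow>\<^sub>0 'r)"
  where "tensor_map f g = lin_ext scale (\<lambda>(x, y). tensor (f (basis x)) (g (basis y)))"

definition tensor_assoc ::
  "(('b \<times> 'c) \<times> 'd \<Rightarrow>\<^sub>0 'r::{comm_ring,comm_monoid_mult}) \<Rightarrow> ('b \<times> 'c \<times> 'd \<Rightarrow>\<^sub>0 'r)"
  where "tensor_assoc = lin_ext scale (\<lambda>((x, y), z). basis (x, (y, z)))"


section \<open>Hopf algebras whose underlying module is free\<close>

text \<open>
  All structures live on the free module with a given basis \<open>B\<close>; the multiplication and the unit
  are arbitrary and need not be related to the basis.
\<close>

definition unital_algebra ::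
  "'b set \<Rightarrow> (('b \<Rightarrow>\<^sub>0 'r) \<Rightarrow> ('b \<Rightarrow>\<^sub>0 'r) \<Rightarrow> 'b \<Rightarrow>\<^sub>0 'r) \<Rightarrow>
   ('b \<Rightarrow>\<^sub>0 'r::{comm_ring,comm_monoid_mult}) \<Rightarrow> bool"
  where "unital_algebra B mul one \<longleftrightarrow>
    (let M = free_module B in
      bilinear_on M scale M scale M scale mul \<and> one \<in> M \<and>
      (\<forall>p\<in>M. \<forall>q\<in>M. \<forall>r\<in>M. mul (mul p q) r = mul p (mul q r)) \<and>
      (\<forall>p\<in>M. mul one p = p \<and> mul p one = p))"

definition algebra_hom ::
  "'b set \<Rightarrow> (('b \<Rightarrow>\<^sub>0 'r) \<Rightarrow> ('b \<Rightarrow>\<^sub>0 'r) \<Rightarrow> 'b \<Rightarrow>\<^sub>0 'r) \<Rightarrow> ('b \<Rightarrow>\<^sub>0 'r) \<Rightarrow>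
   'c set \<Rightarrow> (('c \<Rightarrow>\<^sub>0 'r) \<Rightarrow> ('c \<Rightarrow>\<^sub>0 'r) \<Rightarrow> 'c \<Rightarrow>\<^sub>0 'r) \<Rightarrow> ('c \<Rightarrow>\<^sub>0 'r) \<Rightarrow>
   (('b \<Rightarrow>\<^sub>0 'r::{comm_ring,comm_monoid_mult}) \<Rightarrow> 'c \<Rightarrow>\<^sub>0 'r) \<Rightarrow> bool"
  where "algebra_hom B mul one C mul' one' f \<longleftrightarrow>
    linear_on (free_module B) scale (free_module C) scale f \<and>
    (\<forall>p\<in>free_module B. \<forall>q\<in>free_module B. f (mul p q) = mul' (f p) (f q)) \<and>
    f one = one'"

text \<open>
  The multiplication \<open>(a \<otimes> a') (b \<otimes> b') = ab \<otimes> a'b'\<close> of the tensor square, defined by bilinear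
  extension; see \<open>tensor_mult_tensor\<close> below.
\<close>

definition tensor_mult ::
  "(('b \<Rightarrow>\<^sub>0 'r) \<Rightarrow> ('b \<Rightarrow>\<^sub>0 'r) \<Rightarrow> 'b \<Rightarrow>\<^sub>0 'r) \<Rightarrow>
   ('b \<times> 'b \<Rightarrow>\<^sub>0 'r::{comm_ring,comm_monoid_mult}) \<Rightarrow> ('b \<times> 'b \<Rightarrow>\<^sub>0 'r) \<Rightarrow> ('b \<times> 'b \<Rightarrow>\<^sub>0 'r)"
  where "tensor_mult mul =
    bilin_ext (\<lambda>(x, x') (y, y'). tensor (mul (basis x) (basis y)) (mul (basis x') (basis y')))"

definition tensor_algebra_hom ::
  "'b set \<Rightarrow> (('b \<Rightarrow>\<^sub>0 'r) \<Rightarrow> ('b \<Rightarrow>\<^sub>0 'r) \<Rightarrow> 'b \<Rightarrow>\<^sub>0 'r) \<Rightarrow> ('b \<Rightarrow>\<^sub>0 'r) \<Rightarrow>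
   (('b \<Rightarrow>\<^sub>0 'r::{comm_ring,comm_monoid_mult}) \<Rightarrow> ('b \<times> 'b \<Rightarrow>\<^sub>0 'r)) \<Rightarrow> bool"
  where "tensor_algebra_hom B mul one \<Delta> \<longleftrightarrow>
    algebra_hom B mul one (B \<times> B) (tensor_mult mul) (tensor one one) \<Delta>"

definition coassociative ::
  "'b set \<Rightarrow> (('b \<Rightarrow>\<^sub>0 'r::{comm_ring,comm_monoid_mult}) \<Rightarrow> ('b \<times> 'b \<Rightarrow>\<^sub>0 'r)) \<Rightarrow> bool"
  where "coassociative B \<Delta> \<longleftrightarrow>
    (\<forall>p\<in>free_module B.
      tensor_assoc (tensor_map \<Delta> id (\<Delta> p)) = tensor_map id \<Delta> (\<Delta> p))"

definition bialgebra ::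
  "'b set \<Rightarrow> (('b \<Rightarrow>\<^sub>0 'r) \<Rightarrow> ('b \<Rightarrow>\<^sub>0 'r) \<Rightarrow> 'b \<Rightarrow>\<^sub>0 'r) \<Rightarrow> ('b \<Rightarrow>\<^sub>0 'r) \<Rightarrow>
   (('b \<Rightarrow>\<^sub>0 'r::{comm_ring,comm_monoid_mult}) \<Rightarrow> ('b \<times> 'b \<Rightarrow>\<^sub>0 'r)) \<Rightarrow> bool"
  where "bialgebra B mul one \<Delta> \<longleftrightarrow>
    unital_algebra B mul one \<and> tensor_algebra_hom B mul one \<Delta> \<and> coassociative B \<Delta>"

text \<open>
  A counit is a homomorphism of algebras to the base ring with \<open>(\<epsilon> \<otimes> id) \<Delta> = id = (id \<otimes> \<epsilon>) \<Delta>\<close>,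
  where \<open>R \<otimes> P\<close> and \<open>P \<otimes> R\<close> are identified with \<open>P\<close>.
\<close>

definition is_counit ::
  "'b set \<Rightarrow> (('b \<Rightarrow>\<^sub>0 'r) \<Rightarrow> ('b \<Rightarrow>\<^sub>0 'r) \<Rightarrow> 'b \<Rightarrow>\<^sub>0 'r) \<Rightarrow> ('b \<Rightarrow>\<^sub>0 'r) \<Rightarrow>
   (('b \<Rightarrow>\<^sub>0 'r::{comm_ring,comm_monoid_mult}) \<Rightarrow> ('b \<times> 'b \<Rightarrow>\<^sub>0 'r)) \<Rightarrow>
   (('b \<Rightarrow>\<^sub>0 'r) \<Rightarrow> 'r) \<Rightarrow> bool"
  where "is_counit B mul one \<Delta> \<epsilon> \<longleftrightarrow>
    linear_on (free_module B) scale UNIV (*) \<epsilon> \<and>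
    (\<forall>p\<in>free_module B. \<forall>q\<in>free_module B. \<epsilon> (mul p q) = \<epsilon> p * \<epsilon> q) \<and>
    \<epsilon> one = 1 \<and>
    (\<forall>p\<in>free_module B.
      lin_ext scale (\<lambda>(x, y). scale (\<epsilon> (basis x)) (basis y)) (\<Delta> p) = p \<and>
      lin_ext scale (\<lambda>(x, y). scale (\<epsilon> (basis y)) (basis x)) (\<Delta> p) = p)"

definition mult_map ::
  "(('b \<Rightarrow>\<^sub>0 'r) \<Rightarrow> ('b \<Rightarrow>\<^sub>0 'r) \<Rightarrow> 'b \<Rightarrow>\<^sub>0 'r) \<Rightarrow>
   ('b \<times> 'b \<Rightarrow>\<^sub>0 'r::{comm_ring,comm_monoid_mult}) \<Rightarrow> 'b \<Rightarrow>\<^sub>0 'r"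
  where "mult_map mul = lin_ext scale (\<lambda>(x, y). mul (basis x) (basis y))"

definition is_antipode ::
  "'b set \<Rightarrow> (('b \<Rightarrow>\<^sub>0 'r) \<Rightarrow> ('b \<Rightarrow>\<^sub>0 'r) \<Rightarrow> 'b \<Rightarrow>\<^sub>0 'r) \<Rightarrow> ('b \<Rightarrow>\<^sub>0 'r) \<Rightarrow>
   (('b \<Rightarrow>\<^sub>0 'r::{comm_ring,comm_monoid_mult}) \<Rightarrow> ('b \<times> 'b \<Rightarrow>\<^sub>0 'r)) \<Rightarrow>
   (('b \<Rightarrow>\<^sub>0 'r) \<Rightarrow> 'r) \<Rightarrow> (('b \<Rightarrow>\<^sub>0 'r) \<Rightarrow> 'b \<Rightarrow>\<^sub>0 'r) \<Rightarrow> bool"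
  where "is_antipode B mul one \<Delta> \<epsilon> S \<longleftrightarrow>
    linear_on (free_module B) scale (free_module B) scale S \<and>
    (\<forall>p\<in>free_module B.
      mult_map mul (tensor_map S id (\<Delta> p)) = scale (\<epsilon> p) one \<and>
      mult_map mul (tensor_map id S (\<Delta> p)) = scale (\<epsilon> p) one)"

definition hopf_algebra ::
  "'b set \<Rightarrow> (('b \<Rightarrow>\<^sub>0 'r) \<Rightarrow> ('b \<Rightarrow>\<^sub>0 'r) \<Rightarrow> 'b \<Rightarrow>\<^sub>0 'r) \<Rightarrow> ('b \<Rightarrow>\<^sub>0 'r) \<Rightarrow>
   (('b \<Rightarrow>\<^sub>0 'r::{comm_ring,comm_monoid_mult}) \<Rightarrow> ('b \<times> 'b \<Rightarrow>\<^sub>0 'r)) \<Rightarrow> bool"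
  where "hopf_algebra B mul one \<Delta> \<longleftrightarrow>
    bialgebra B mul one \<Delta> \<and>
    (\<exists>\<epsilon>. is_counit B mul one \<Delta> \<epsilon> \<and> (\<exists>S. is_antipode B mul one \<Delta> \<epsilon> S))"


section \<open>Words, phrases and cuts\<close>

definition words :: "'a set \<Rightarrow> 'a list set"
  where "words A = lists A - {[]}"

text \<open>The letters of a word are numbered from 1, and \<open>subword w i j = w(i) \<dots> w(j - 1)\<close>.\<close>

definition subword :: "'a list \<Rightarrow> nat \<Rightarrow> nat \<Rightarrow> 'a list"
  where "subword w i j = take (j - i) (drop (i - 1) w)"

definition stable :: "'a set \<Rightarrow> 'a list set \<Rightarrow> bool"
  where "stable A L \<longleftrightarrow>
    L \<subseteq> words A \<and>
    (\<forall>w\<in>words A. \<forall>i j.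
      1 \<le> i \<and> i < j \<and> j \<le> length w + 1 \<and> (i, j) \<noteq> (1, length w + 1) \<and> subword w i j \<in> L \<longrightarrow>
      (w \<in> L \<longleftrightarrow> subword w 1 i @ subword w j (length w + 1) \<in> L))"

definition phrases :: "'a set \<Rightarrow> 'a list list set"
  where "phrases A = lists (words A)"

definition phrase_mult ::
  "('a list list \<Rightarrow>\<^sub>0 'r) \<Rightarrow> ('a list list \<Rightarrow>\<^sub>0 'r) \<Rightarrow>
   'a list list \<Rightarrow>\<^sub>0 'r::{comm_ring,comm_monoid_mult}"
  where "phrase_mult = bilin_ext (\<lambda>x y. basis (x @ y))"

definition phrase_one :: "'a list list \<Rightarrow>\<^sub>0 'r::{comm_ring,comm_monoid_mult}"
  where "phrase_one = basis []"

text \<open>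
  The sequence \<open>(i\<^sub>1, j\<^sub>1, \<dots>, i\<^sub>k, j\<^sub>k)\<close> is given as the list \<open>[(i\<^sub>1, j\<^sub>1), \<dots>, (i\<^sub>k, j\<^sub>k)]\<close>. Since
  \<open>i < j\<close> in each pair, comparing all pairs of entries instead of adjacent ones makes no
  difference.
\<close>

definition cuts :: "'a list set \<Rightarrow> 'a list \<Rightarrow> (nat \<times> nat) list set"
  where "cuts L w = {c.
    (\<forall>(i, j)\<in>set c. 1 \<le> i \<and> i < j \<and> j \<le> length w + 1 \<and> subword w i j \<in> L) \<and>
    sorted_wrt (\<lambda>(i, j) (i', j'). j < i') c \<and>
    c \<noteq> [(1, length w + 1)]}"

definition cut_left :: "'a list \<Rightarrow> (nat \<times> nat) list \<Rightarrow> 'a list list"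
  where "cut_left w c = map (\<lambda>(i, j). subword w i j) c"

fun cut_right_from :: "'a list \<Rightarrow> nat \<Rightarrow> (nat \<times> nat) list \<Rightarrow> 'a list"
  where
    "cut_right_from w s [] = subword w s (length w + 1)"
  | "cut_right_from w s ((i, j) # c) = subword w s i @ cut_right_from w j c"

definition cut_right :: "'a list \<Rightarrow> (nat \<times> nat) list \<Rightarrow> 'a list"
  where "cut_right w c = cut_right_from w 1 c"

definition cut_coproduct ::
  "'a list set \<Rightarrow> 'a list \<Rightarrow> ('a list list \<times> 'a list list \<Rightarrow>\<^sub>0 'r::{comm_ring,comm_monoid_mult})"
  where "cut_coproduct L w =
    tensor (basis [w]) phrase_one +
    (\<Sum>c\<in>cuts L w. tensor (basis (cut_left w c)) (basis [cut_right w c]))"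

text \<open>
  The characterisation of \<open>\<Delta>\<^sub>L\<close>; by \<open>cut_comultiplication_exists\<close> and
  \<open>cut_comultiplication_unique\<close> below it determines exactly one map on the algebra of phrases.
  Values of \<open>\<Delta>\<close> outside \<open>free_module (phrases A)\<close> are irrelevant.
\<close>

definition cut_comultiplication ::
  "'a set \<Rightarrow> 'a list set \<Rightarrow>
   (('a list list \<Rightarrow>\<^sub>0 'r::{comm_ring,comm_monoid_mult}) \<Rightarrow> ('a list list \<times> 'a list list \<Rightarrow>\<^sub>0 'r)) \<Rightarrow> bool"
  where "cut_comultiplication A L \<Delta> \<longleftrightarrow>
    tensor_algebra_hom (phrases A) phrase_mult phrase_one \<Delta> \<and>
    (\<forall>w\<in>words A. \<Delta> (basis [w]) = cut_coproduct L w)"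


section \<open>Adequacy of the definitions\<close>

subsection \<open>Linear extensions\<close>

lemma lookup_scale [simp]: "Poly_Mapping.lookup (scale c p) x = c * Poly_Mapping.lookup p x"
  by (auto simp: scale_def Poly_Mapping.map.rep_eq when_def)

lemma module_scale_scale: "module_scale scale"
  by (auto simp: module_scale_def algebra_simps intro!: poly_mapping_eqI simp: lookup_add)

lemma module_scale_zero:
  assumes "module_scale s"
  shows "s 0 x = 0" "s a 0 = 0"
proof -
  have "s (0 + 0) x = s 0 x + s 0 x" "s a (0 + 0) = s a 0 + s a 0"
    using assms unfolding module_scale_def by blast+
  then show "s 0 x = 0" "s a 0 = 0" by simp_all
qed

lemma module_scale_sum:
  assumes "module_scale s"
  shows "s a (sum f I) = (\<Sum>i\<in>I. s a (f i))"
  using assms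
  by (induction I rule: infinite_finite_induct)
    (auto simp: module_scale_zero, simp add: module_scale_def)

lemma lin_ext_superset:
  assumes "module_scale s" "finite K" "Poly_Mapping.keys p \<subseteq> K"
  shows "lin_ext s f p = (\<Sum>x\<in>K. s (Poly_Mapping.lookup p x) (f x))"
  unfolding lin_ext_def
  by (rule sum.mono_neutral_left) (use assms in \<open>auto simp: in_keys_iff module_scale_zero\<close>)

lemma lin_ext_zero [simp]: "lin_ext s f 0 = 0"
  by (simp add: lin_ext_def)

lemma lin_ext_add:
  assumes s: "module_scale s"
  shows "lin_ext s f (p + q) = lin_ext s f p + lin_ext s f q"
proof -
  let ?K = "Poly_Mapping.keys p \<union> Poly_Mapping.keys q"
  have "lin_ext s f (p + q) = (\<Sum>x\<in>?K. s (Poly_Mapping.lookup (p + q) x) (f x))"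
    by (rule lin_ext_superset[OF s]) (auto intro: keys_add[THEN subsetD] dest: keys_add[THEN subsetD])
  also have "\<dots> = (\<Sum>x\<in>?K. s (Poly_Mapping.lookup p x) (f x)) + (\<Sum>x\<in>?K. s (Poly_Mapping.lookup q x) (f x))"
    using s by (simp add: lookup_add module_scale_def sum.distrib)
  finally show ?thesis
    using lin_ext_superset[OF s, of ?K p f] lin_ext_superset[OF s, of ?K q f] by simp
qed

lemma lin_ext_scale:
  assumes s: "module_scale s"
  shows "lin_ext s f (scale c p) = s c (lin_ext s f p)"
proof -
  have "lin_ext s f (scale c p) = (\<Sum>x\<in>Poly_Mapping.keys p. s (Poly_Mapping.lookup (scale c p) x) (f x))"
    by (rule lin_ext_superset[OF s]) (auto simp: in_keys_iff)
  also have "\<dots> = s c (lin_ext s f p)"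
    using s by (simp add: lin_ext_def module_scale_sum[OF s] module_scale_def)
  finally show ?thesis .
qed

lemma lin_ext_basis [simp]:
  assumes s: "module_scale s"
  shows "lin_ext s f (basis x) = f x"
  using s lin_ext_superset[OF s, of "{x}" "basis x" f]
  by (simp add: basis_def module_scale_def)

lemma linear_on_lin_ext:
  assumes "module_scale s"
  shows "linear_on (free_module B) scale UNIV s (lin_ext s f)"
  by (auto simp: linear_on_def lin_ext_add lin_ext_scale assms)

lemmas lin_ext_simps [simp] =
  lin_ext_add[OF module_scale_scale] lin_ext_scale[OF module_scale_scale]
  lin_ext_basis[OF module_scale_scale]

lemma scale_simps [simp]:
  "scale 1 p = p" "scale a (p + q) = scale a p + scale a q" "scale a (scale b p) = scale (a * b) p"
  "scale a 0 = 0"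
  by (auto intro!: poly_mapping_eqI simp: lookup_add algebra_simps)

lemma keys_scale: "Poly_Mapping.keys (scale c p) \<subseteq> Poly_Mapping.keys p"
  by (auto simp: in_keys_iff)

lemma free_module_zero [simp]: "0 \<in> free_module B"
  by (simp add: free_module_def)

lemma free_module_add:
  "p \<in> free_module B \<Longrightarrow> q \<in> free_module B \<Longrightarrow> p + q \<in> free_module B"
  using keys_add[of p q] by (auto simp: free_module_def)

lemma free_module_scale: "p \<in> free_module B \<Longrightarrow> scale c p \<in> free_module B"
  using keys_scale[of c p] by (auto simp: free_module_def)

lemma free_module_basis: "x \<in> B \<Longrightarrow> basis x \<in> free_module B"
  by (simp add: free_module_def basis_def)

lemma free_module_sum: "(\<And>i. i \<in> I \<Longrightarrow> f i \<in> free_module B) \<Longrightarrow> sum f I \<in> free_module B"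
  by (induction I rule: infinite_finite_induct) (auto intro: free_module_add)

lemma lin_ext_in:
  assumes "p \<in> free_module B" "\<And>x. x \<in> B \<Longrightarrow> f x \<in> free_module C"
  shows "lin_ext scale f p \<in> free_module C"
  unfolding lin_ext_def
proof (intro free_module_sum free_module_scale assms(2))
  fix x assume "x \<in> Poly_Mapping.keys p"
  with assms(1) show "x \<in> B" by (auto simp: free_module_def)
qed

lemma basis_expansion: "lin_ext scale basis p = p"
proof (rule poly_mapping_eqI)
  fix k
  show "Poly_Mapping.lookup (lin_ext scale basis p) k = Poly_Mapping.lookup p k"
    by (auto simp: lin_ext_def lookup_sum basis_def lookup_single when_def in_keys_iff
        if_distrib[of "\<lambda>z. _ * z"] cong: if_cong)
qed

lemma free_module_induct [consumes 1, case_names zero add basis]: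
  assumes "p \<in> free_module B"
    and "P 0"
    and "\<And>p q. p \<in> free_module B \<Longrightarrow> q \<in> free_module B \<Longrightarrow> P p \<Longrightarrow> P q \<Longrightarrow> P (p + q)"
    and "\<And>c x. x \<in> B \<Longrightarrow> P (scale c (basis x))"
  shows "P p"
proof -
  have sum: "P (sum g I) \<and> sum g I \<in> free_module B"
    if "\<And>i. i \<in> I \<Longrightarrow> P (g i) \<and> g i \<in> free_module B" for g and I :: "'a set"
    using that by (induction I rule: infinite_finite_induct) (auto intro: assms free_module_add)
  have "P (scale c (basis x)) \<and> scale c (basis x) \<in> free_module B"
    if "x \<in> Poly_Mapping.keys p" for c x
  proof -
    have "x \<in> B" using that assms(1) by (auto simp: free_module_def)
    then show ?thesis using assms(4) by (simp add: free_module_scale free_module_basis)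
  qed
  then have "P (lin_ext scale basis p)"
    unfolding lin_ext_def by (intro sum[THEN conjunct1])
  then show ?thesis by (simp add: basis_expansion)
qed

lemma linear_on_zero:
  assumes "linear_on (free_module B) scale N t f"
  shows "f 0 = 0"
proof -
  have "f (0 + 0) = f 0 + f 0"
    using assms unfolding linear_on_def by (metis free_module_zero)
  then show ?thesis by simp
qed

lemma linear_on_eqI:
  assumes "linear_on (free_module B) scale M s f" "linear_on (free_module B) scale N s g"
    and "\<And>x. x \<in> B \<Longrightarrow> f (basis x) = g (basis x)"
    and "p \<in> free_module B"
  shows "f p = g p"
  using assms(4)
proof (induction rule: free_module_induct)
  case zero
  then show ?case using assms(1,2)[THEN linear_on_zero] by simp
next
  case (add p q)
  then show ?case using assms(1,2) by (simp add: linear_on_def)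
next
  case (basis c x)
  then have "basis x \<in> free_module B" by (rule free_module_basis)
  then have "f (scale c (basis x)) = s c (f (basis x))" "g (scale c (basis x)) = s c (g (basis x))"
    using assms(1,2) unfolding linear_on_def by blast+
  then show ?case using assms(3)[OF basis] by simp
qed

lemma free_module_UNIV [simp]: "p \<in> free_module UNIV"
  by (simp add: free_module_def)

lemma bilin_ext_add1: "bilin_ext f (p + p') q = bilin_ext f p q + bilin_ext f p' q"
  and bilin_ext_scale1: "bilin_ext f (scale c p) q = scale c (bilin_ext f p q)"
  by (simp_all add: bilin_ext_def)

lemma bilin_ext_swap: "bilin_ext f p q = lin_ext scale (\<lambda>y. lin_ext scale (\<lambda>x. f x y) p) q"
  unfolding bilin_ext_def lin_ext_def
  by (subst (1 2) module_scale_sum[OF module_scale_scale], subst sum.swap)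
    (simp add: mult.commute)

lemma bilin_ext_add2: "bilin_ext f p (q + q') = bilin_ext f p q + bilin_ext f p q'"
  and bilin_ext_scale2: "bilin_ext f p (scale c q) = scale c (bilin_ext f p q)"
  by (simp_all add: bilin_ext_swap)

lemmas bilin_ext_simps = bilin_ext_add1 bilin_ext_add2 bilin_ext_scale1 bilin_ext_scale2

lemma bilin_ext_basis [simp]: "bilin_ext f (basis x) (basis y) = f x y"
  by (simp add: bilin_ext_def)

lemma bilin_ext_zero [simp]: "bilin_ext f 0 q = 0" "bilin_ext f p 0 = 0"
  by (simp add: bilin_ext_def) (simp add: bilin_ext_swap)

lemma bilin_ext_bilinear:
  assumes "\<And>x y. x \<in> B \<Longrightarrow> y \<in> C \<Longrightarrow> f x y \<in> free_module D"
  shows "bilinear_on (free_module B) scale (free_module C) scale (free_module D) scale (bilin_ext f)"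
  using assms by (auto simp: bilinear_on_def linear_on_def bilin_ext_simps) (auto simp: bilin_ext_def intro!: lin_ext_in)

subsection \<open>The tensor product\<close>

lemma tensor_basis [simp]: "tensor (basis x) (basis y) = basis (x, y)"
  by (simp add: tensor_def)

lemma tensor_bilinear:
  "bilinear_on (free_module B) scale (free_module C) scale (free_module (B \<times> C)) scale tensor"
  unfolding tensor_def by (rule bilin_ext_bilinear) (auto intro: free_module_basis)

lemma tensor_map_tensor:
  assumes f: "linear_on (free_module B) scale M scale f"
    and g: "linear_on (free_module C) scale N scale g"
    and p: "p \<in> free_module B" and q: "q \<in> free_module C"
  shows "tensor_map f g (tensor p q) = tensor (f p) (g q)"
proof (rule linear_on_eqI[OF _ _ _ p, where f = "\<lambda>p. tensor_map f g (tensor p q)"])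
  show "linear_on (free_module B) scale UNIV scale (\<lambda>p. tensor_map f g (tensor p q))"
    by (auto simp: linear_on_def tensor_map_def tensor_def bilin_ext_simps)
  show "linear_on (free_module B) scale UNIV scale (\<lambda>p. tensor (f p) (g q))"
    using f by (auto simp: linear_on_def tensor_def bilin_ext_simps)
  fix x
  show "tensor_map f g (tensor (basis x) q) = tensor (f (basis x)) (g q)"
  proof (rule linear_on_eqI[OF _ _ _ q, where f = "\<lambda>q. tensor_map f g (tensor (basis x) q)"])
    show "linear_on (free_module C) scale UNIV scale (\<lambda>q. tensor_map f g (tensor (basis x) q))"
      by (auto simp: linear_on_def tensor_map_def tensor_def bilin_ext_simps)
    show "linear_on (free_module C) scale UNIV scale (\<lambda>q. tensor (f (basis x)) (g q))"
      using g by (auto simp: linear_on_def tensor_def bilin_ext_simps)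
    show "tensor_map f g (tensor (basis x) (basis y)) = tensor (f (basis x)) (g (basis y))" for y
      by (simp add: tensor_map_def)
  qed
qed

lemma tensor_universal:
  fixes s :: "'r::{comm_ring,comm_monoid_mult} \<Rightarrow> 'm::ab_group_add \<Rightarrow> 'm"
    and \<beta> :: "('b \<Rightarrow>\<^sub>0 'r) \<Rightarrow> ('c \<Rightarrow>\<^sub>0 'r) \<Rightarrow> 'm"
  assumes s: "module_scale s"
    and \<beta>: "bilinear_on (free_module B) scale (free_module C) scale UNIV s \<beta>"
  shows "\<exists>f. linear_on (free_module (B \<times> C)) scale UNIV s f \<and>
      (\<forall>p\<in>free_module B. \<forall>q\<in>free_module C. f (tensor p q) = \<beta> p q)"
    and "linear_on (free_module (B \<times> C)) scale UNIV s f \<Longrightarrow>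
      linear_on (free_module (B \<times> C)) scale UNIV s g \<Longrightarrow>
      (\<forall>p\<in>free_module B. \<forall>q\<in>free_module C. f (tensor p q) = g (tensor p q)) \<Longrightarrow>
      \<forall>u\<in>free_module (B \<times> C). f u = g u"
proof -
  let ?f = "lin_ext s (\<lambda>(x, y). \<beta> (basis x) (basis y))"
  have lin: "linear_on (free_module (B \<times> C)) scale UNIV s ?f"
    by (rule linear_on_lin_ext[OF s])
  have "?f (tensor p q) = \<beta> p q" if p: "p \<in> free_module B" and q: "q \<in> free_module C" for p q
  proof (rule linear_on_eqI[OF _ _ _ p, where f = "\<lambda>p. ?f (tensor p q)" and g = "\<lambda>p. \<beta> p q"])
    show "linear_on (free_module B) scale UNIV s (\<lambda>p. ?f (tensor p q))"
      by (auto simp: linear_on_def tensor_def bilin_ext_simps lin_ext_add[OF s] lin_ext_scale[OF s])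
    show "linear_on (free_module B) scale UNIV s (\<lambda>p. \<beta> p q)"
      using \<beta> q by (simp add: bilinear_on_def)
    fix x assume x: "x \<in> B"
    show "?f (tensor (basis x) q) = \<beta> (basis x) q"
    proof (rule linear_on_eqI[OF _ _ _ q, where f = "\<lambda>q. ?f (tensor (basis x) q)" and g = "\<beta> (basis x)"])
      show "linear_on (free_module C) scale UNIV s (\<lambda>q. ?f (tensor (basis x) q))"
        by (auto simp: linear_on_def tensor_def bilin_ext_simps lin_ext_add[OF s] lin_ext_scale[OF s])
      show "linear_on (free_module C) scale UNIV s (\<beta> (basis x))"
        using \<beta> x by (simp add: bilinear_on_def free_module_basis)
      show "?f (tensor (basis x) (basis y)) = \<beta> (basis x) (basis y)" for y
        by (simp add: s)
    qed
  qed
  with lin show "\<exists>f. linear_on (free_module (B \<times> C)) scale UNIV s f \<and>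
      (\<forall>p\<in>free_module B. \<forall>q\<in>free_module C. f (tensor p q) = \<beta> p q)" by blast
next
  assume f: "linear_on (free_module (B \<times> C)) scale UNIV s f"
    and g: "linear_on (free_module (B \<times> C)) scale UNIV s g"
    and eq: "\<forall>p\<in>free_module B. \<forall>q\<in>free_module C. f (tensor p q) = g (tensor p q)"
  have "f (basis z) = g (basis z)" if "z \<in> B \<times> C" for z
    using eq[rule_format, of "basis (fst z)" "basis (snd z)"] that by (auto simp: free_module_basis)
  with f g show "\<forall>u\<in>free_module (B \<times> C). f u = g u"
    using linear_on_eqI by blast
qed

subsection \<open>Existence and uniqueness of the comultiplication\<close>

lemma finite_cuts [simp]: "finite (cuts L w)"
proof -
  have *: "distinct c" if "sorted_wrt (\<lambda>(i, j) (i', j'). j < i') c"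
    "\<forall>(i, j)\<in>set c. i < j" for c :: "(nat \<times> nat) list"
    using that by (induction c) fastforce+
  have "cuts L w \<subseteq> {c. set c \<subseteq> {0..length w + 1} \<times> {0..length w + 1} \<and> distinct c}"
    using * by (fastforce simp: cuts_def)
  moreover have "finite {c. set c \<subseteq> {0..length w + 1} \<times> {0..length w + 1} \<and> distinct c}"
    by (rule finite_subset_distinct) simp
  ultimately show ?thesis by (rule finite_subset)
qed

lemma tensor_mult_tensor:
  assumes alg: "unital_algebra B mul one"
    and "a \<in> free_module B" "a' \<in> free_module B" "b \<in> free_module B" "b' \<in> free_module B"
  shows "tensor_mult mul (tensor a a') (tensor b b') = tensor (mul a b) (mul a' b')"
proof -
  have bil: "bilinear_on (free_module B) scale (free_module B) scale (free_module B) scale mul"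
    using alg by (simp add: unital_algebra_def Let_def)
  have lin1: "linear_on (free_module B) scale UNIV scale (\<lambda>x. tensor_mult mul (F x) G)"
    if "linear_on (free_module B) scale UNIV scale F" for F G
    using that by (auto simp: linear_on_def tensor_mult_def bilin_ext_simps)
  have lin2: "linear_on (free_module B) scale UNIV scale (\<lambda>x. tensor_mult mul G (F x))"
    if "linear_on (free_module B) scale UNIV scale F" for F G
    using that by (auto simp: linear_on_def tensor_mult_def bilin_ext_simps)
  have t1: "linear_on (free_module B) scale UNIV scale (\<lambda>x. tensor (F x) G)"
    if "linear_on (free_module B) scale N scale F" for F N and G :: "'a \<Rightarrow>\<^sub>0 'b"
    using that by (auto simp: linear_on_def tensor_def bilin_ext_simps)
  have t2: "linear_on (free_module B) scale UNIV scale (\<lambda>x. tensor G (F x))"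
    if "linear_on (free_module B) scale N scale F" for F N and G :: "'a \<Rightarrow>\<^sub>0 'b"
    using that by (auto simp: linear_on_def tensor_def bilin_ext_simps)
  have idl: "linear_on (free_module B) scale UNIV scale (\<lambda>x. x)"
    by (auto simp: linear_on_def)
  have m1: "linear_on (free_module B) scale (free_module B) scale (\<lambda>x. mul x q)"
    and m2: "linear_on (free_module B) scale (free_module B) scale (mul q)"
    if "q \<in> free_module B" for q
    using bil that by (simp_all add: bilinear_on_def)
  note fb = free_module_basis
  have 1: "tensor_mult mul (tensor (basis x) (basis x')) (tensor (basis y) (basis y')) =
      tensor (mul (basis x) (basis y)) (mul (basis x') (basis y'))" for x x' y y'
    by (simp add: tensor_mult_def)
  have 2: "tensor_mult mul (tensor (basis x) (basis x')) (tensor (basis y) b') =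
      tensor (mul (basis x) (basis y)) (mul (basis x') b')" if "x' \<in> B" for x x' y
    by (rule linear_on_eqI[OF lin2[OF t2[OF idl]] t2[OF m2[OF fb[OF that]]] 1 assms(5)])
  have 3: "tensor_mult mul (tensor (basis x) (basis x')) (tensor b b') =
      tensor (mul (basis x) b) (mul (basis x') b')" if "x \<in> B" "x' \<in> B" for x x'
    by (rule linear_on_eqI[OF lin2[OF t1[OF idl]] t1[OF m2[OF fb[OF that(1)]]] 2[OF that(2)] assms(4)])
  have 4: "tensor_mult mul (tensor (basis x) a') (tensor b b') =
      tensor (mul (basis x) b) (mul a' b')" if "x \<in> B" for x
    by (rule linear_on_eqI[OF lin1[OF t2[OF idl]] t2[OF m1[OF assms(5)]] 3[OF that] assms(3)])
  show ?thesis
    by (rule linear_on_eqI[OF lin1[OF t1[OF idl]] t1[OF m1[OF assms(4)]] 4 assms(2)])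
qed

lemma bilin_ext_basis_assoc:
  assumes "\<And>x y z. m (m x y) z = m x (m y z)"
  defines "mu \<equiv> bilin_ext (\<lambda>x y. basis (m x y))"
  shows "mu (mu p q) r = mu p (mu q r)"
proof -
  have lin: "linear_on (free_module UNIV) scale UNIV scale (\<lambda>x. mu (F x) G)"
    "linear_on (free_module UNIV) scale UNIV scale (\<lambda>x. mu G (F x))"
    if "linear_on (free_module UNIV) scale UNIV scale F" for F G
    using that by (auto simp: linear_on_def mu_def bilin_ext_simps)
  have idl: "linear_on (free_module UNIV) scale UNIV scale (\<lambda>x. x)"
    by (auto simp: linear_on_def)
  have 1: "mu (mu (basis x) (basis y)) (basis z) = mu (basis x) (mu (basis y) (basis z))" for x y z
    using assms(1) by (simp add: mu_def)
  have 2: "mu (mu (basis x) (basis y)) r = mu (basis x) (mu (basis y) r)" for x y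
    by (rule linear_on_eqI[OF lin(2)[OF idl] lin(2)[OF lin(2)[OF idl]] 1 free_module_UNIV])
  have 3: "mu (mu (basis x) q) r = mu (basis x) (mu q r)" for x
    by (rule linear_on_eqI[OF lin(1)[OF lin(2)[OF idl]] lin(2)[OF lin(1)[OF idl]] 2 free_module_UNIV])
  show ?thesis
    by (rule linear_on_eqI[OF lin(1)[OF lin(1)[OF idl]] lin(1)[OF idl] 3 free_module_UNIV])
qed

lemma bilin_ext_basis_unit:
  assumes "\<And>x. m e x = x" "\<And>x. m x e = x"
  shows "bilin_ext (\<lambda>x y. basis (m x y)) (basis e) p = p"
    "bilin_ext (\<lambda>x y. basis (m x y)) p (basis e) = p"
  by (simp_all add: bilin_ext_swap[of _ p] assms basis_expansion)
    (simp add: bilin_ext_def assms basis_expansion)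

lemma unital_algebra_phrases:
  "unital_algebra (phrases A) phrase_mult
    (phrase_one :: 'a list list \<Rightarrow>\<^sub>0 'r::{comm_ring,comm_monoid_mult})"
proof -
  have "phrase_mult (phrase_mult p q) r = phrase_mult p (phrase_mult q r)"
    for p q r :: "'a list list \<Rightarrow>\<^sub>0 'r"
    unfolding phrase_mult_def by (rule bilin_ext_basis_assoc) simp
  moreover have "phrase_mult phrase_one p = p" "phrase_mult p phrase_one = p"
    for p :: "'a list list \<Rightarrow>\<^sub>0 'r"
    unfolding phrase_mult_def phrase_one_def by (rule bilin_ext_basis_unit; simp)+
  moreover have "bilinear_on (free_module (phrases A)) scale (free_module (phrases A)) scale
      (free_module (phrases A)) scale
      (phrase_mult :: _ \<Rightarrow> _ \<Rightarrow> 'a list list \<Rightarrow>\<^sub>0 'r)"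
    unfolding phrase_mult_def
    by (rule bilin_ext_bilinear) (auto simp: phrases_def intro!: free_module_basis)
  moreover have "(phrase_one :: _ \<Rightarrow>\<^sub>0 'r) \<in> free_module (phrases A)"
    unfolding phrase_one_def by (rule free_module_basis) (simp add: phrases_def)
  ultimately show ?thesis
    by (simp add: unital_algebra_def Let_def)
qed

lemma tensor_mult_phrase_mult:
  "tensor_mult phrase_mult = bilin_ext (\<lambda>z z'. basis (fst z @ fst z', snd z @ snd z'))"
  by (simp add: tensor_mult_def phrase_mult_def case_prod_unfold)

lemma subword_in: "w \<in> lists A \<Longrightarrow> subword w i j \<in> lists A"
  by (auto simp: subword_def in_lists_conv_set dest: in_set_takeD in_set_dropD)

lemma subword_nonempty: "1 \<le> i \<Longrightarrow> i < j \<Longrightarrow> i \<le> length w \<Longrightarrow> subword w i j \<noteq> []"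
  by (auto simp: subword_def)

lemma cut_left_in:
  assumes "w \<in> words A" "c \<in> cuts L w"
  shows "cut_left w c \<in> phrases A"
proof -
  have "subword w i j \<in> words A" if "(i, j) \<in> set c" for i j
  proof -
    have "1 \<le> i" "i < j" "j \<le> length w + 1"
      using that assms(2) by (auto simp: cuts_def)
    then have "subword w i j \<noteq> []" by (intro subword_nonempty) auto
    with assms(1) show ?thesis by (simp add: words_def subword_in del: in_lists_conv_set)
  qed
  then show ?thesis by (auto simp: cut_left_def phrases_def)
qed

lemma cut_right_from_in: "w \<in> lists A \<Longrightarrow> cut_right_from w s c \<in> lists A"
  by (induction w s c rule: cut_right_from.induct)
    (simp_all only: cut_right_from.simps append_in_lists_conv subword_in simp_thms)

lemma cut_right_nonempty:
  assumes "w \<noteq> []" "c \<in> cuts L w"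
  shows "cut_right w c \<noteq> []"
proof (cases c)
  case Nil
  then show ?thesis using assms(1) by (simp add: cut_right_def subword_def)
next
  case (Cons p c')
  obtain i j where p: "p = (i, j)" by (cases p)
  have ij: "1 \<le> i" "i < j" "j \<le> length w + 1" using assms Cons p by (auto simp: cuts_def)
  show ?thesis
  proof (cases "i = 1")
    case False
    then have "subword w 1 i \<noteq> []" using ij assms(1) by (intro subword_nonempty) (auto simp: Suc_le_eq)
    then show ?thesis by (simp add: cut_right_def Cons p)
  next
    case True
    show ?thesis
    proof (cases c')
      case Nil
      then have "j \<noteq> length w + 1" using assms(2) Cons p True by (simp add: cuts_def)
      then have "subword w j (length w + 1) \<noteq> []" using ij by (intro subword_nonempty) auto
      then show ?thesis by (simp add: cut_right_def Cons p Nil)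
    next
      case (Cons p' c'')
      obtain i' j' where p': "p' = (i', j')" by (cases p')
      have "j < i'" "i' < j'" "j' \<le> length w + 1"
        using assms(2) \<open>c = p # c'\<close> Cons p p' by (auto simp: cuts_def)
      then have "subword w j i' \<noteq> []" using ij by (intro subword_nonempty) auto
      then show ?thesis by (simp add: cut_right_def \<open>c = p # c'\<close> Cons p p')
    qed
  qed
qed

lemma cut_coproduct_in:
  assumes "w \<in> words A"
  shows "cut_coproduct L w \<in> free_module (phrases A \<times> phrases A)"
proof -
  have w: "[w] \<in> phrases A" "[] \<in> phrases A" using assms by (auto simp: phrases_def)
  have c: "[cut_right w c] \<in> phrases A" if "c \<in> cuts L w" for c
    using that assms cut_right_nonempty[of w c L] cut_right_from_in[of w A 1 c]
    by (auto simp: phrases_def words_def cut_right_def)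
  show ?thesis
    unfolding cut_coproduct_def phrase_one_def using w c cut_left_in[OF assms]
    by (auto intro!: free_module_add free_module_sum free_module_basis)
qed

lemma cut_comultiplication_exists:
  "\<exists>\<Delta> :: ('a list list \<Rightarrow>\<^sub>0 'r::{comm_ring,comm_monoid_mult}) \<Rightarrow> _. cut_comultiplication A L \<Delta>"
proof -
  let ?B = "phrases A" and ?m = "tensor_mult phrase_mult :: ('a list list \<times> 'a list list \<Rightarrow>\<^sub>0 'r) \<Rightarrow> _"
    and ?e = "basis ([], []) :: 'a list list \<times> 'a list list \<Rightarrow>\<^sub>0 'r"
  define d :: "'a list list \<Rightarrow> ('a list list \<times> 'a list list \<Rightarrow>\<^sub>0 'r)"
    where "d x = List.foldr (\<lambda>w. ?m (cut_coproduct L w)) x ?e" for x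
  define \<Delta> where "\<Delta> = lin_ext scale d"
  have assoc: "?m (?m p q) r = ?m p (?m q r)" for p q r
    unfolding tensor_mult_phrase_mult by (rule bilin_ext_basis_assoc) simp
  have unit: "?m ?e p = p" "?m p ?e = p" for p
    unfolding tensor_mult_phrase_mult by (rule bilin_ext_basis_unit; simp)+
  have closed: "?m p q \<in> free_module (?B \<times> ?B)"
    if "p \<in> free_module (?B \<times> ?B)" "q \<in> free_module (?B \<times> ?B)" for p q
  proof -
    have "bilinear_on (free_module (?B \<times> ?B)) scale (free_module (?B \<times> ?B)) scale
      (free_module (?B \<times> ?B)) scale ?m"
      unfolding tensor_mult_phrase_mult
      by (rule bilin_ext_bilinear) (auto simp: phrases_def intro!: free_module_basis)
    with that show ?thesis by (simp add: bilinear_on_def linear_on_def)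
  qed
  have d_app: "d (x @ y) = ?m (d x) (d y)" for x y
    by (induction x) (simp_all add: d_def unit assoc)
  have d_in: "d x \<in> free_module (?B \<times> ?B)" if "x \<in> ?B" for x
    using that
    by (induction x) (auto simp: d_def phrases_def intro!: closed[unfolded phrases_def]
        cut_coproduct_in[unfolded phrases_def] free_module_basis)
  have mult: "\<Delta> (phrase_mult p q) = ?m (\<Delta> p) (\<Delta> q)" for p q
  proof (rule linear_on_eqI[OF _ _ _ free_module_UNIV,
      where f = "\<lambda>p. \<Delta> (phrase_mult p q)" and g = "\<lambda>p. ?m (\<Delta> p) (\<Delta> q)"])
    show "linear_on (free_module UNIV) scale UNIV scale (\<lambda>p. \<Delta> (phrase_mult p q))"
      "linear_on (free_module UNIV) scale UNIV scale (\<lambda>p. ?m (\<Delta> p) (\<Delta> q))"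
      by (auto simp: linear_on_def \<Delta>_def phrase_mult_def tensor_mult_def bilin_ext_simps)
    show "\<Delta> (phrase_mult (basis x) q) = ?m (\<Delta> (basis x)) (\<Delta> q)" for x
    proof (rule linear_on_eqI[OF _ _ _ free_module_UNIV,
        where f = "\<lambda>q. \<Delta> (phrase_mult (basis x) q)" and g = "\<lambda>q. ?m (\<Delta> (basis x)) (\<Delta> q)"])
      show "linear_on (free_module UNIV) scale UNIV scale (\<lambda>q. \<Delta> (phrase_mult (basis x) q))"
        "linear_on (free_module UNIV) scale UNIV scale (\<lambda>q. ?m (\<Delta> (basis x)) (\<Delta> q))"
        by (auto simp: linear_on_def \<Delta>_def phrase_mult_def tensor_mult_def bilin_ext_simps)
      show "\<Delta> (phrase_mult (basis x) (basis y)) = ?m (\<Delta> (basis x)) (\<Delta> (basis y))" for y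
        by (simp add: \<Delta>_def phrase_mult_def d_app)
    qed
  qed
  have "cut_comultiplication A L \<Delta>"
    unfolding cut_comultiplication_def tensor_algebra_hom_def algebra_hom_def
  proof (intro conjI ballI)
    show "linear_on (free_module ?B) scale (free_module (?B \<times> ?B)) scale \<Delta>"
      by (auto simp: linear_on_def \<Delta>_def intro!: lin_ext_in d_in)
    show "\<Delta> phrase_one = tensor phrase_one phrase_one"
      by (simp add: \<Delta>_def phrase_one_def d_def)
    show "\<Delta> (basis [w]) = cut_coproduct L w" for w
      by (simp add: \<Delta>_def d_def unit)
  qed (rule mult)
  then show ?thesis by blast
qed

lemma cut_comultiplication_unique:
  assumes "cut_comultiplication A L \<Delta>" "cut_comultiplication A L \<Delta>'"
    and "p \<in> free_module (phrases A)"
  shows "\<Delta> p = \<Delta>' p"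
proof (rule linear_on_eqI[OF _ _ _ assms(3)])
  show "linear_on (free_module (phrases A)) scale (free_module (phrases A \<times> phrases A)) scale \<Delta>"
    "linear_on (free_module (phrases A)) scale (free_module (phrases A \<times> phrases A)) scale \<Delta>'"
    using assms(1,2) by (simp_all add: cut_comultiplication_def tensor_algebra_hom_def algebra_hom_def)
  fix x assume "x \<in> phrases A"
  then show "\<Delta> (basis x) = \<Delta>' (basis x)"
  proof (induction x)
    case Nil
    then show ?case
      using assms(1,2)
      by (simp add: cut_comultiplication_def tensor_algebra_hom_def algebra_hom_def phrase_one_def)
  next
    case (Cons w x)
    then have w: "w \<in> words A" and x: "x \<in> phrases A" by (auto simp: phrases_def)
    have eq: "basis (w # x) = phrase_mult (basis [w]) (basis x)"
      by (simp add: phrase_mult_def)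
    have "basis [w] \<in> free_module (phrases A)" "basis x \<in> free_module (phrases A)"
      using w x by (auto intro!: free_module_basis simp: phrases_def)
    then have "D (basis (w # x)) = tensor_mult phrase_mult (cut_coproduct L w) (D (basis x))"
      if "cut_comultiplication A L D" for D
      using that w
      unfolding eq cut_comultiplication_def tensor_algebra_hom_def algebra_hom_def by metis
    then show ?case
      using assms(1,2) Cons.IH[OF x] by metis
  qed
qed

end

theory Submission
  imports Defs
begin

text \<open>
  Since consecutive intervals of a cut are separated by at least one letter, a cut of \<open>w\<close> is the
  same as a marking of some, but not all, letters of \<open>w\<close> whose maximal marked runs lie in \<open>L\<close>.
  The remaining term \<open>w \<otimes> 1\<close> of \<open>\<Delta> w\<close> is the contribution of the marking of all letters, if the empty
  word is read as the empty phrase.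

  Both sides of coassociativity on a word are sums over colourings of its letters with three colours,
  one for each tensor factor. The two
  sides impose different conditions on the colouring, and stability makes these conditions equivalent.
  Multiplicativity of \<open>\<Delta>\<close> extends coassociativity to phrases.

  The counit is the coefficient of the empty phrase. The coproduct preserves the total number of
  letters, and only the empty phrase has none. So the identity has a left and a right inverse for
  convolution, both given by recursion on the number of letters; they agree by associativity.
\<close>

section \<open>Maximal runs\<close>

function blocks :: "('b \<Rightarrow> bool) \<Rightarrow> 'b list \<Rightarrow> 'b list list" where
  "blocks P [] = []"
| "blocks P (x # xs) =
    (if P x then (x # takeWhile P xs) # blocks P (dropWhile P xs) else blocks P xs)"
  by pat_completeness auto
termination
  by (relation "measure (\<lambda>(P, xs). length xs)") (simp_all add: le_imp_less_Suc length_dropWhile_le)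

lemma takeWhile_append_stop:
  "v = [] \<or> \<not> P (hd v) \<Longrightarrow> takeWhile P (u @ v) = takeWhile P u"
  by (induction u) (cases v; auto)+

lemma dropWhile_append_stop:
  "v = [] \<or> \<not> P (hd v) \<Longrightarrow> dropWhile P (u @ v) = dropWhile P u @ v"
  by (induction u) (cases v; auto)+

text \<open>A run crossing from \<open>u\<close> to \<open>v\<close> would contain the head of
  \<open>v\<close>, which violates \<open>P\<close>.\<close>

lemma blocks_append:
  "v = [] \<or> \<not> P (hd v) \<Longrightarrow> blocks P (u @ v) = blocks P u @ blocks P v"
  by (induction P u rule: blocks.induct)
    (simp_all add: takeWhile_append_stop dropWhile_append_stop)

lemma blocks_all: "\<forall>x\<in>set u. P x \<Longrightarrow> blocks P u = (if u = [] then [] else [u])"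
  by (cases u) (auto simp: takeWhile_eq_all_conv[THEN iffD2] dropWhile_eq_Nil_conv[THEN iffD2])

lemma blocks_none: "\<forall>x\<in>set u. \<not> P x \<Longrightarrow> blocks P u = []"
  by (induction u) auto

lemma blocks_none_append: "\<forall>x\<in>set u. \<not> P x \<Longrightarrow> blocks P (u @ v) = blocks P v"
  by (induction u) auto

lemma blocks_map: "blocks P (map f u) = map (map f) (blocks (\<lambda>x. P (f x)) u)"
proof (induction "length u" arbitrary: u rule: less_induct)
  case less
  show ?case
  proof (cases u)
    case (Cons x v)
    then have "length (dropWhile (\<lambda>x. P (f x)) v) < length u" "length v < length u"
      by (simp_all add: le_imp_less_Suc length_dropWhile_le)
    then show ?thesis
      using less[of "dropWhile (\<lambda>x. P (f x)) v"] less[of v] Cons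
      by (simp add: takeWhile_map dropWhile_map comp_def)
  qed simp
qed

text \<open>Elements satisfying \<open>P\<close> fill the runs and the others survive the filter.
  This count later shows that the coproduct preserves the number of letters.\<close>

lemma length_concat_blocks: "length (concat (blocks P t)) + length (filter (\<lambda>x. \<not> P x) t) = length t"
proof (induction P t rule: blocks.induct)
  case (2 P x xs)
  have "filter (\<lambda>x. \<not> P x) xs = filter (\<lambda>x. \<not> P x) (takeWhile P xs @ dropWhile P xs)" by simp
  also have "\<dots> = filter (\<lambda>x. \<not> P x) (dropWhile P xs)"
    unfolding filter_append by (auto simp: filter_empty_conv dest: set_takeWhileD)
  moreover have "length xs = length (takeWhile P xs) + length (dropWhile P xs)"
    by (metis length_append takeWhile_dropWhile_id)
  ultimately show ?case using 2 by simp
qed simp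

text \<open>Induction by whole runs: in the last case \<open>u\<close> is exactly the first run, so
  \<open>blocks\<close> splits it off in one piece.\<close>

lemma blocks_induct [case_names Nil skip block]:
  assumes "Q []"
    and "\<And>x xs. \<not> P x \<Longrightarrow> Q xs \<Longrightarrow> Q (x # xs)"
    and "\<And>u v. u \<noteq> [] \<Longrightarrow> \<forall>x\<in>set u. P x \<Longrightarrow> v = [] \<or> \<not> P (hd v) \<Longrightarrow> Q v \<Longrightarrow> Q (u @ v)"
  shows "Q xs"
proof (induction xs rule: length_induct)
  case (1 xs)
  show ?case
  proof (cases xs)
    case (Cons x ys)
    show ?thesis
    proof (cases "P x")
      case True
      have "Q (dropWhile P ys)"
        using 1 Cons by (simp add: le_imp_less_Suc length_dropWhile_le)
      moreover have "dropWhile P ys = [] \<or> \<not> P (hd (dropWhile P ys))"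
        using hd_dropWhile by blast
      ultimately have "Q ((x # takeWhile P ys) @ dropWhile P ys)"
        using True by (intro assms(3)) (auto dest: set_takeWhileD)
      then show ?thesis using Cons by simp
    qed (use 1 Cons assms(2) in auto)
  qed (use assms(1) in simp)
qed

lemma blocks_block:
  "u \<noteq> [] \<Longrightarrow> \<forall>x\<in>set u. P x \<Longrightarrow> v = [] \<or> \<not> P (hd v) \<Longrightarrow> blocks P (u @ v) = u # blocks P v"
  by (simp add: blocks_append blocks_all)

lemma set_blocks: "u \<in> set (blocks P t) \<Longrightarrow> u \<noteq> [] \<and> set u \<subseteq> set t \<and> (\<forall>x\<in>set u. P x)"
proof (induction t rule: blocks_induct[where P = P])
  case (block v w)
  then show ?case unfolding blocks_block[OF block.hyps] by auto
qed (auto split: if_splits)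

section \<open>Markings and three-colourings\<close>

text \<open>For the cut whose intervals are the maximal marked runs, \<open>cut_blocks\<close> and
  \<open>cut_rest\<close> are \<open>l_c(w)\<close> and \<open>r_c(w)\<close>.\<close>

definition cut_blocks :: "('a \<times> bool) list \<Rightarrow> 'a list list"
  where "cut_blocks b = map (map fst) (blocks snd b)"

definition cut_rest :: "('a \<times> bool) list \<Rightarrow> 'a list"
  where "cut_rest b = map fst (filter (\<lambda>x. \<not> snd x) b)"

text \<open>The second alternative admits the total marking even if the word is not in
  \<open>L\<close>; it stands for the term \<open>w \<otimes> 1\<close>. If the word is in
  \<open>L\<close>, this marking is still counted only once, matching the exclusion of the cut
  \<open>(1, m + 1)\<close>.\<close>

definition admissible :: "'a list set \<Rightarrow> ('a \<times> bool) list \<Rightarrow> bool"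
  where "admissible L b \<longleftrightarrow> set (cut_blocks b) \<subseteq> L \<or> (\<forall>x\<in>set b. snd x)"

definition markings :: "'a list set \<Rightarrow> 'a list \<Rightarrow> ('a \<times> bool) list set"
  where "markings L w = {b. map fst b = w \<and> admissible L b}"

definition phrase_markings :: "'a list set \<Rightarrow> 'a list list \<Rightarrow> ('a \<times> bool) list list set"
  where "phrase_markings L x = {X. map (map fst) X = x \<and> (\<forall>b\<in>set X. admissible L b)}"

definition phrase_of :: "'a list \<Rightarrow> 'a list list"
  where "phrase_of w = (if w = [] then [] else [w])"

text \<open>Stability with the positions replaced by a prefix \<open>f\<close> and a suffix
  \<open>v\<close>; \<open>f @ v \<noteq> []\<close> expresses that the deleted part is not the
  whole word.\<close>

lemma stable_remove:
  assumes "stable A L" "f @ u @ v \<in> lists A" "u \<in> L" "f @ v \<noteq> []"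
  shows "f @ u @ v \<in> L \<longleftrightarrow> f @ v \<in> L"
proof -
  let ?w = "f @ u @ v" and ?i = "length f + 1" and ?j = "length f + length u + 1"
  have u: "u \<noteq> []" using assms(1,3) by (auto simp: stable_def words_def)
  have "subword ?w ?i ?j = u" "subword ?w 1 ?i = f" "subword ?w ?j (length ?w + 1) = v"
    by (simp_all add: subword_def)
  moreover have "?w \<in> words A" using assms(2) u by (simp add: words_def)
  moreover have "1 \<le> ?i" "?i < ?j" "?j \<le> length ?w + 1" "(?i, ?j) \<noteq> (1, length ?w + 1)"
    using u assms(4) by auto
  ultimately show ?thesis using assms(1,3) unfolding stable_def by metis
qed

text \<open>The marked runs are deleted one at a time from the left by \<open>stable_remove\<close>.
  The prefix \<open>f\<close> collects the unmarked letters already passed, so that each deletion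
  takes place inside the whole word.\<close>

lemma stable_cut_rest:
  assumes "stable A L" "f @ map fst b \<in> lists A" "set (cut_blocks b) \<subseteq> L" "f @ cut_rest b \<noteq> []"
  shows "f @ map fst b \<in> L \<longleftrightarrow> f @ cut_rest b \<in> L"
  using assms(2-)
proof (induction b arbitrary: f rule: blocks_induct[where P = snd])
  case (skip x b)
  then show ?case using skip.IH[of "f @ [fst x]"] by (simp add: cut_blocks_def cut_rest_def)
next
  case (block u v)
  have "cut_rest (u @ v) = cut_rest v" using block.hyps(2) by (simp add: cut_rest_def)
  moreover have "cut_blocks (u @ v) = map fst u # cut_blocks v"
    using block.hyps by (simp add: cut_blocks_def blocks_block)
  \<comment> \<open>The word left after deleting only \<open>u\<close> contains all letters of the
    final word, which is non-empty.\<close>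
  moreover from calculation have "f @ map fst v \<noteq> []"
    using block.prems(3) by (auto simp: cut_rest_def)
  ultimately show ?case
    using block.IH[of f] block.prems stable_remove[OF assms(1), of f "map fst u" "map fst v"] by simp
qed (simp_all add: cut_rest_def)

text \<open>
  The colours \<open>Some True\<close>, \<open>Some False\<close>, \<open>None\<close> stand for the first, second and third tensor factor.
  The function \<open>outer\<close> reads a colouring as a term of \<open>(\<Delta> \<otimes> id) \<Delta>\<close> (a marking of the word and one
  of each of its runs), and \<open>inner\<close> reads it as a term of \<open>(id \<otimes> \<Delta>) \<Delta>\<close> (a marking of the word and
  one of the remaining word).
\<close>

definition outer :: "('a \<times> bool option) list \<Rightarrow> ('a \<times> bool) list \<times> ('a \<times> bool) list list"
  where "outer t = (map (apsnd (\<lambda>c. c \<noteq> None)) t,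
    map (map (apsnd the)) (blocks (\<lambda>x. snd x \<noteq> None) t))"

definition inner :: "('a \<times> bool option) list \<Rightarrow> ('a \<times> bool) list \<times> ('a \<times> bool) list"
  where "inner t = (map (apsnd (\<lambda>c. c = Some True)) t,
    map (apsnd (\<lambda>c. c = Some False)) (filter (\<lambda>x. snd x \<noteq> Some True) t))"

section \<open>Comparison of the two readings of a colouring\<close>

lemma outer_blocks: "map (map fst) (snd (outer t)) = cut_blocks (fst (outer t))"
  by (simp add: outer_def cut_blocks_def blocks_map comp_def)

lemma inner_rest: "map fst (snd (inner t)) = cut_rest (fst (inner t))"
  by (simp add: inner_def cut_rest_def filter_map comp_def)

text \<open>Both sides list the letters coloured \<open>None\<close>.\<close>

lemma outer_inner_rest: "cut_rest (fst (outer t)) = cut_rest (snd (inner t))"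
  unfolding outer_def inner_def cut_rest_def
  by (simp add: filter_map comp_def) (rule arg_cong[of _ _ "map fst"], induction t, auto)

lemma Some_map_the: "\<forall>x\<in>set u. snd x \<noteq> None \<Longrightarrow>
  map (apsnd the) u = map (apsnd (\<lambda>c. c = Some True)) u"
  by auto

lemma outer_Cons_None: "snd x = None \<Longrightarrow>
  outer (x # t) = ((fst x, False) # fst (outer t), snd (outer t))"
  by (cases x) (simp add: outer_def)

lemma outer_block: "u \<noteq> [] \<Longrightarrow> \<forall>x\<in>set u. snd x \<noteq> None \<Longrightarrow> v = [] \<or> snd (hd v) = None \<Longrightarrow>
  outer (u @ v) = (map (\<lambda>x. (fst x, True)) u @ fst (outer v), map (apsnd the) u # snd (outer v))"
  using blocks_block[of u "\<lambda>x. snd x \<noteq> None" v] by (auto simp: outer_def)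

text \<open>First claim: every run of colour \<open>Some True\<close> lies inside a run of letters
  not coloured \<open>None\<close>. Second claim: once the letters coloured \<open>Some True\<close>
  are deleted, the letters coloured \<open>Some False\<close> of one such larger run become adjacent
  and form one run or nothing, while letters coloured \<open>None\<close> keep different larger runs
  apart.\<close>

lemma outer_inner_blocks:
  "concat (map cut_blocks (snd (outer t))) = cut_blocks (fst (inner t))"
  "concat (map (\<lambda>b. phrase_of (cut_rest b)) (snd (outer t))) = cut_blocks (snd (inner t))"
proof (induction t rule: blocks_induct[where P = "\<lambda>x. snd x \<noteq> None"])
  case Nil
  case 1 show ?case by (simp add: outer_def inner_def cut_blocks_def)
  case 2 show ?case by (simp add: outer_def inner_def cut_blocks_def)
next
  case (skip x t)
  case 1 then show ?case using skip by (simp add: outer_Cons_None) (simp add: inner_def cut_blocks_def)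
  case 2 then show ?case using skip by (simp add: outer_Cons_None) (simp add: inner_def cut_blocks_def)
next
  case (block u v)
  let ?d = "\<lambda>t. map (apsnd (\<lambda>c. c = Some False)) (filter (\<lambda>x. snd x \<noteq> Some True) t)"
  case 1
  have "cut_blocks (fst (inner (u @ v))) = cut_blocks (map (apsnd the) u) @ cut_blocks (fst (inner v))"
    using block.hyps unfolding Some_map_the[OF block.hyps(2)]
    by (cases v) (auto simp: inner_def cut_blocks_def blocks_append)
  then show ?case using block by (simp add: outer_block)
  case 2
  \<comment> \<open>\<open>v\<close> can only start with a letter coloured \<open>None\<close>; this
    letter survives the filter unmarked, so no run crosses from \<open>?d u\<close> to
    \<open>?d v\<close>.\<close>
  have "?d v = [] \<or> \<not> snd (hd (?d v))"
    using block.hyps(3) by (cases v) auto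
  then have "cut_blocks (snd (inner (u @ v))) = cut_blocks (?d u) @ cut_blocks (snd (inner v))"
    by (simp add: inner_def cut_blocks_def blocks_append)
  moreover have "cut_blocks (?d u) = phrase_of (cut_rest (map (apsnd the) u))"
  proof -
    have 1: "\<forall>x\<in>set (?d u). snd x" using block.hyps(2) by auto
    have "filter (\<lambda>x. \<not> the (snd x)) u = filter (\<lambda>x. snd x \<noteq> Some True) u"
      using block.hyps(2) by (intro filter_cong) auto
    then show ?thesis
      using blocks_all[OF 1] by (auto simp: cut_blocks_def cut_rest_def phrase_of_def filter_map comp_def)
  qed
  ultimately show ?case using block by (simp add: outer_block)
qed

text \<open>The colour of each letter is forced: \<open>None\<close> if it is unmarked in
  \<open>b\<close>, otherwise \<open>Some\<close> of its mark in \<open>X\<close>. The hypothesis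
  says that the entries of \<open>X\<close> mark the runs of \<open>b\<close> in order, so each run
  uses up one entry.\<close>

lemma outer_ex1:
  assumes "map (map fst) X = cut_blocks b"
  shows "\<exists>!t. outer t = (b, X)"
  using assms
proof (induction b arbitrary: X rule: blocks_induct[where P = snd])
  case Nil
  then show ?case by (auto simp: outer_def cut_blocks_def)
next
  case (skip x b)
  obtain a where x: "x = (a, False)" using skip by (cases x) auto
  then obtain t where t: "outer t = (b, X)" and u: "\<And>t'. outer t' = (b, X) \<Longrightarrow> t' = t"
    using skip by (fastforce simp: cut_blocks_def)
  show ?case
  proof (rule ex1I[of _ "(a, None) # t"])
    show "outer ((a, None) # t) = (x # b, X)" using t x by (simp add: outer_Cons_None)
    fix t' assume *: "outer t' = (x # b, X)"
    then obtain t'' where t': "t' = (a, None) # t''"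
      unfolding outer_def x by (cases t') auto
    with * have "outer t'' = (b, X)" using x by (auto simp: outer_Cons_None prod_eq_iff)
    then show "t' = (a, None) # t" using t' u by simp
  qed
next
  case (block u v)
  from block.hyps block.prems obtain X0 X' where X: "X = X0 # X'" "map fst X0 = map fst u"
    "map (map fst) X' = cut_blocks v"
    by (auto simp: cut_blocks_def blocks_block)
  from block.IH[OF X(3)] obtain t where t: "outer t = (v, X')"
    and uq: "\<And>t'. outer t' = (v, X') \<Longrightarrow> t' = t" by blast
  \<comment> \<open>If \<open>v\<close> is non-empty it starts with an unmarked letter, so its
    colouring starts with \<open>None\<close> and a run put in front cannot merge with it.\<close>
  have stop: "t' = [] \<or> snd (hd t') = None" if "outer t' = (v, Y)" for t' Y
    using that block.hyps(3) by (cases t') (auto simp: outer_def)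
  have eq: "map (\<lambda>x. (fst x, True)) X0 = u"
  proof -
    have "map (\<lambda>x. (fst x, True)) X0 = map (\<lambda>a. (a, True)) (map fst X0)" by simp
    also have "\<dots> = map (\<lambda>x. (fst x, True)) u" unfolding X(2) by simp
    also have "\<dots> = u" using block.hyps(2) by (intro map_idI) auto
    finally show ?thesis .
  qed
  have ne: "X0 \<noteq> []" using eq block.hyps(1) by auto
  show ?case
  proof (rule ex1I[of _ "map (apsnd Some) X0 @ t"])
    show "outer (map (apsnd Some) X0 @ t) = (u @ v, X)"
      using ne stop[OF t] eq X(1)
      by (subst outer_block) (auto simp: t intro!: map_idI)
    fix t' assume *: "outer t' = (u @ v, X)"
    then obtain t1 t2 where t': "t' = t1 @ t2" and t1: "map (apsnd (\<lambda>c. c \<noteq> None)) t1 = u"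
      and t2: "fst (outer t2) = v"
      by (auto simp: outer_def map_eq_append_conv)
    have some: "\<forall>x\<in>set t1. snd x \<noteq> None" using block.hyps(2) unfolding t1[symmetric] by simp
    have "outer t' = (u @ v, map (apsnd the) t1 # snd (outer t2))"
    proof -
      have "t1 \<noteq> []" "t2 = [] \<or> snd (hd t2) = None"
        using t1 block.hyps(1) stop[of t2 "snd (outer t2)"] t2 by (auto simp: prod_eq_iff)
      moreover have "map (\<lambda>x. (fst x, True)) t1 = u"
        unfolding t1[symmetric] using some by (intro map_cong refl) (simp add: prod_eq_iff)
      ultimately show ?thesis unfolding t' using some t2 by (simp add: outer_block)
    qed
    then have "map (apsnd the) t1 = X0" "outer t2 = (v, X')" using * X(1) t2 by (auto simp: prod_eq_iff)
    moreover have "map (apsnd Some) (map (apsnd the) t1) = t1"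
      unfolding map_map using some by (intro map_idI) (fastforce simp: prod_eq_iff)
    ultimately show "t' = map (apsnd Some) X0 @ t" using t' uq by simp
  qed
qed

text \<open>Again the colour is forced: letters marked in \<open>c\<close> get
  \<open>Some True\<close>, and each unmarked letter takes the next mark of \<open>d\<close>, true
  meaning \<open>Some False\<close> and false meaning \<open>None\<close>.\<close>

lemma inner_ex1:
  assumes "map fst d = cut_rest c"
  shows "\<exists>!t. inner t = (c, d)"
  using assms
proof (induction c arbitrary: d)
  case Nil
  then show ?case by (auto simp: inner_def cut_rest_def)
next
  case (Cons x c)
  obtain a m where x: "x = (a, m)" by (cases x)
  show ?case
  proof (cases m)
    case True
    then obtain t where t: "inner t = (c, d)" and u: "\<And>t'. inner t' = (c, d) \<Longrightarrow> t' = t"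
      using Cons x by (fastforce simp: cut_rest_def)
    show ?thesis
      by (rule ex1I[of _ "(a, Some True) # t"])
        (use t x True in \<open>auto simp: inner_def map_eq_Cons_conv intro!: u\<close>)
  next
    case False
    then obtain n d' where d: "d = (a, n) # d'" "map fst d' = cut_rest c"
      using Cons.prems x by (cases d) (auto simp: cut_rest_def)
    then obtain t where t: "inner t = (c, d')" and u: "\<And>t'. inner t' = (c, d') \<Longrightarrow> t' = t"
      using Cons.IH by fastforce
    show ?thesis
    proof (rule ex1I[of _ "(a, if n then Some False else None) # t"])
      show "inner ((a, if n then Some False else None) # t) = (x # c, d)"
        using t x False d by (auto simp: inner_def)
      fix t' assume *: "inner t' = (x # c, d)"
      then obtain m' t'' where t': "t' = (a, m') # t''" "m' \<noteq> Some True"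
        using x False by (cases t') (auto simp: inner_def)
      then have "inner t'' = (c, d')" "m' = (if n then Some False else None)"
        using * x d by (cases m'; auto simp: inner_def)+
      then show "t' = (a, if n then Some False else None) # t" using t' u by simp
    qed
  qed
qed

text \<open>These are the conditions that \<open>outer\<close> (left) and \<open>inner\<close>
  (right) impose on a single run. If \<open>b\<close> is totally marked, both say that its word is
  in \<open>L\<close>; otherwise stability permits deleting the marked runs without changing
  membership in \<open>L\<close>.\<close>

lemma admissible_block:
  assumes "stable A L" "map fst b \<in> words A"
  shows "map fst b \<in> L \<and> admissible L b \<longleftrightarrow>
    set (cut_blocks b) \<subseteq> L \<and> set (phrase_of (cut_rest b)) \<subseteq> L"
proof (cases "\<forall>x\<in>set b. snd x")
  case True
  then have "cut_rest b = []" "cut_blocks b = [map fst b]"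
    using assms(2) by (auto simp: cut_rest_def cut_blocks_def blocks_all words_def)
  then show ?thesis using True by (auto simp: phrase_of_def admissible_def)
next
  case False
  then have "cut_rest b \<noteq> []" by (auto simp: cut_rest_def filter_empty_conv)
  then show ?thesis
    using False stable_cut_rest[OF assms(1), of "[]" b] assms(2)
    by (auto simp: phrase_of_def admissible_def words_def)
qed

lemma admissible_outer_inner:
  assumes "stable A L" "map fst t \<in> lists A"
  shows "admissible L (fst (outer t)) \<and> (\<forall>b\<in>set (snd (outer t)). admissible L b) \<longleftrightarrow>
    admissible L (fst (inner t)) \<and> admissible L (snd (inner t))"
proof (cases "\<forall>x\<in>set t. snd x \<noteq> None")
  \<comment> \<open>No letter goes to the third factor, so a non-empty word is a single run. The
    markings \<open>fst (outer t)\<close> and \<open>snd (inner t)\<close> are total, and the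
    remaining two coincide.\<close>
  case True
  have "snd (outer t) = (if t = [] then [] else [fst (inner t)])"
    using True blocks_all[OF True] Some_map_the[OF True] by (auto simp: outer_def inner_def)
  moreover have "admissible L (fst (outer t))" "admissible L (snd (inner t))"
    using True by (auto simp: admissible_def outer_def inner_def)
  moreover have "admissible L (fst (inner []))"
    by (simp add: admissible_def inner_def)
  ultimately show ?thesis by auto
next
  \<comment> \<open>A letter coloured \<open>None\<close> is unmarked in
    \<open>fst (outer t)\<close>, \<open>fst (inner t)\<close> and \<open>snd (inner t)\<close>. So
    none of these is total, and the conditions split into conditions on the single runs.\<close>
  case False
  let ?X = "snd (outer t)"
  have words: "map fst b \<in> words A" if "b \<in> set ?X" for b
  proof -
    from that obtain u where "u \<in> set (blocks (\<lambda>x. snd x \<noteq> None) t)" "map fst b = map fst u"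
      by (auto simp: outer_def)
    then show ?thesis
      using set_blocks[of u _ t] assms(2) by (fastforce simp: words_def)
  qed
  have "admissible L (fst (outer t)) \<longleftrightarrow> (\<forall>b\<in>set ?X. map fst b \<in> L)"
    using False by (auto simp: admissible_def outer_blocks[symmetric]) (auto simp: outer_def)
  moreover have "admissible L (fst (inner t)) \<longleftrightarrow> (\<forall>b\<in>set ?X. set (cut_blocks b) \<subseteq> L)"
    using False by (auto simp: admissible_def outer_inner_blocks[symmetric]) (fastforce simp: inner_def)
  moreover have "admissible L (snd (inner t)) \<longleftrightarrow> (\<forall>b\<in>set ?X. set (phrase_of (cut_rest b)) \<subseteq> L)"
    using False by (auto simp: admissible_def outer_inner_blocks[symmetric]) (fastforce simp: inner_def)
  ultimately show ?thesis using admissible_block[OF assms(1) words] by blast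
qed

section \<open>Summation over colourings\<close>

lemma bij_betw_ex1: "(\<And>y. y \<in> S \<Longrightarrow> \<exists>!t. h t = y) \<Longrightarrow> bij_betw h {t. h t \<in> S} S"
  by (rule bij_betw_imageI) (auto simp: inj_on_def image_iff, metis)

lemma finite_markings [simp]: "finite (markings L w)"
proof (rule finite_subset)
  show "markings L w \<subseteq> {b. set b \<subseteq> set w \<times> UNIV \<and> length b = length w}"
    by (force simp: markings_def)
qed (intro finite_lists_length_eq finite_SigmaI; simp)

lemma finite_phrase_markings [simp]: "finite (phrase_markings L x)"
proof (rule finite_subset)
  show "phrase_markings L x \<subseteq> {X. set X \<subseteq> (\<Union>w\<in>set x. markings L w) \<and> length X = length x}"
    by (auto simp: markings_def phrase_markings_def)
qed (intro finite_lists_length_eq finite_UN_I; simp)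

text \<open>Both index sets are parametrised by colourings, through \<open>outer\<close> and
  \<open>inner\<close>. \<open>admissible_outer_inner\<close> shows that the same colourings occur;
  \<open>outer_inner_blocks\<close> and \<open>outer_inner_rest\<close> match the summands.\<close>

lemma sum_double_markings:
  assumes "stable A L" "w \<in> lists A"
  shows "(\<Sum>b\<in>markings L w. \<Sum>X\<in>phrase_markings L (cut_blocks b).
      F (concat (map cut_blocks X)) (concat (map (\<lambda>b. phrase_of (cut_rest b)) X)) (cut_rest b)) =
    (\<Sum>c\<in>markings L w. \<Sum>d\<in>markings L (cut_rest c). F (cut_blocks c) (cut_blocks d) (cut_rest d))"
    (is "?lhs = ?rhs")
proof -
  let ?S = "Sigma (markings L w) (\<lambda>b. phrase_markings L (cut_blocks b))"
    and ?S' = "Sigma (markings L w) (\<lambda>c. markings L (cut_rest c))"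
  have "outer t \<in> ?S \<longleftrightarrow> inner t \<in> ?S'" for t
  proof -
    obtain b X c d where o: "outer t = (b, X)" and i: "inner t = (c, d)" by fastforce
    have w: "map fst b = map fst t" "map fst c = map fst t"
      using o i by (auto simp: outer_def inner_def)
    have *: "outer t \<in> ?S \<longleftrightarrow> map fst t = w \<and> admissible L b \<and> (\<forall>b\<in>set X. admissible L b)"
      using outer_blocks[of t] w(1) by (simp add: o markings_def phrase_markings_def)
    have **: "inner t \<in> ?S' \<longleftrightarrow> map fst t = w \<and> admissible L c \<and> admissible L d"
      using inner_rest[of t] w(2) by (simp add: i markings_def)
    show ?thesis
      unfolding * **
      using admissible_outer_inner[OF assms(1), of t, unfolded o i fst_conv snd_conv] assms(2)
      by (cases "map fst t = w") simp_all
  qed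
  then have eq: "{t. outer t \<in> ?S} = {t. inner t \<in> ?S'}" by (rule Collect_cong)
  have outer: "bij_betw outer {t. outer t \<in> ?S} ?S"
  proof (rule bij_betw_ex1)
    fix y assume "y \<in> ?S"
    then show "\<exists>!t. outer t = y"
      using outer_ex1[of "snd y" "fst y"] by (cases y) (simp add: phrase_markings_def)
  qed
  have inner: "bij_betw inner {t. inner t \<in> ?S'} ?S'"
  proof (rule bij_betw_ex1)
    fix y assume "y \<in> ?S'"
    then show "\<exists>!t. inner t = y"
      using inner_ex1[of "snd y" "fst y"] by (cases y) (simp add: markings_def)
  qed
  have "?lhs = (\<Sum>(b, X)\<in>?S. F (concat (map cut_blocks X))
      (concat (map (\<lambda>b. phrase_of (cut_rest b)) X)) (cut_rest b))"
    by (simp add: sum.Sigma)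
  also have "\<dots> = (\<Sum>t\<in>{t. outer t \<in> ?S}. F (cut_blocks (fst (inner t)))
      (cut_blocks (snd (inner t))) (cut_rest (snd (inner t))))"
    by (subst sum.reindex_bij_betw[OF outer, symmetric])
      (simp add: case_prod_unfold outer_inner_blocks outer_inner_rest)
  also have "\<dots> = (\<Sum>(c, d)\<in>?S'. F (cut_blocks c) (cut_blocks d) (cut_rest d))"
    unfolding eq by (subst sum.reindex_bij_betw[OF inner, symmetric]) (simp add: case_prod_unfold)
  also have "\<dots> = ?rhs" by (simp add: sum.Sigma)
  finally show ?thesis .
qed

section \<open>Cuts as markings\<close>

lemma subword_append:
  "1 \<le> i \<Longrightarrow> i \<le> j \<Longrightarrow> j \<le> k \<Longrightarrow> subword w i j @ subword w j k = subword w i k"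
proof -
  assume "1 \<le> i" "i \<le> j" "j \<le> k"
  then obtain m n where "j = i + m" "k = j + n" by (metis le_Suc_ex)
  then show ?thesis using \<open>1 \<le> i\<close> by (simp add: subword_def take_add add.commute)
qed

lemma length_subword: "1 \<le> i \<Longrightarrow> j \<le> length w + 1 \<Longrightarrow> length (subword w i j) = j - i"
  by (auto simp: subword_def)

lemma subword_self [simp]: "subword w i i = []"
  by (simp add: subword_def)

lemma subword_full: "subword w 1 (length w + 1) = w"
  by (simp add: subword_def)

text \<open>The positional part of the cut condition. The lower bound \<open>s\<close> makes the
  tail of a sequence an object of the same kind.\<close>

definition intervals :: "'a list \<Rightarrow> nat \<Rightarrow> (nat \<times> nat) list set"
  where "intervals w s = {c. (\<forall>(i, j)\<in>set c. s \<le> i \<and> i < j \<and> j \<le> length w + 1) \<and>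
    sorted_wrt (\<lambda>(i, j) (i', j'). j < i') c}"

lemma intervals_Nil [simp]: "[] \<in> intervals w s"
  by (simp add: intervals_def)

text \<open>The bound \<open>Suc j\<close> keeps the letter at position \<open>j\<close> between the
  first interval and the next one.\<close>

lemma intervals_Cons [simp]:
  "(i, j) # c \<in> intervals w s \<longleftrightarrow>
    s \<le> i \<and> i < j \<and> j \<le> length w + 1 \<and> c \<in> intervals w (Suc j)"
  unfolding intervals_def by (fastforce simp: Suc_le_eq)

lemma cuts_intervals:
  "c \<in> cuts L w \<longleftrightarrow>
    c \<in> intervals w 1 \<and> set (cut_left w c) \<subseteq> L \<and> c \<noteq> [(1, length w + 1)]"
  by (auto simp: cuts_def intervals_def cut_left_def)

fun cut_marking :: "'a list \<Rightarrow> nat \<Rightarrow> (nat \<times> nat) list \<Rightarrow> ('a \<times> bool) list" where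
  "cut_marking w s [] = map (\<lambda>a. (a, False)) (subword w s (length w + 1))"
| "cut_marking w s ((i, j) # c) =
    map (\<lambda>a. (a, False)) (subword w s i) @ map (\<lambda>a. (a, True)) (subword w i j) @ cut_marking w j c"

text \<open>The inverse of \<open>cut_marking\<close>; \<open>s\<close> is the position in the word
  of the first letter of the list.\<close>

function marked_intervals :: "nat \<Rightarrow> ('a \<times> bool) list \<Rightarrow> (nat \<times> nat) list" where
  "marked_intervals s [] = []"
| "marked_intervals s (x # b) =
    (if snd x then (s, s + length (takeWhile snd (x # b))) #
       marked_intervals (s + length (takeWhile snd (x # b))) (dropWhile snd (x # b))
     else marked_intervals (Suc s) b)"
  by pat_completeness auto
termination
  by (relation "measure (\<lambda>(s, b). length b)") (simp_all add: le_imp_less_Suc length_dropWhile_le)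

lemma marked_intervals_unmarked:
  "marked_intervals s (map (\<lambda>a. (a, False)) u @ b) = marked_intervals (s + length u) b"
  by (induction u arbitrary: s) auto

lemma marked_intervals_block:
  assumes "u \<noteq> []" "\<forall>x\<in>set u. snd x" "b = [] \<or> \<not> snd (hd b)"
  shows "marked_intervals s (u @ b) = (s, s + length u) # marked_intervals (s + length u) b"
proof -
  have "takeWhile snd (u @ b) = u" "dropWhile snd (u @ b) = b"
    using assms takeWhile_append_stop[of b snd u] dropWhile_append_stop[of b snd u] by simp_all
  moreover obtain x u' where u: "u = x # u'" "snd x" using assms by (cases u) auto
  ultimately show ?thesis by simp
qed

text \<open>All intervals start after \<open>s\<close>, so the letter at position \<open>s\<close>,
  if there is one, is unmarked. Hence a marked stretch ending just before \<open>s\<close> is a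
  maximal run.\<close>

lemma cut_marking_stop:
  assumes "1 \<le> s" "c \<in> intervals w (Suc s)"
  shows "cut_marking w s c = [] \<or> \<not> snd (hd (cut_marking w s c))"
proof (cases c)
  case Nil
  then show ?thesis by (cases "subword w s (length w + 1)") auto
next
  case (Cons p c')
  obtain i j where p: "p = (i, j)" by (cases p)
  then have "length (subword w s i) = i - s" "s < i"
    using assms Cons by (simp_all add: length_subword)
  then have "subword w s i \<noteq> []" by auto
  then show ?thesis using Cons p by (cases "subword w s i") auto
qed

lemma intervals_mono: "c \<in> intervals w t \<Longrightarrow> s \<le> t \<Longrightarrow> c \<in> intervals w s"
  by (fastforce simp: intervals_def)

text \<open>Unmarked letters separate the intervals, which are therefore exactly the maximal marked
  runs. One induction serves all four claims.\<close>

lemma cut_marking: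
  assumes "1 \<le> s" "s \<le> length w + 1" "c \<in> intervals w s"
  shows "map fst (cut_marking w s c) = subword w s (length w + 1)"
    and "cut_blocks (cut_marking w s c) = cut_left w c"
    and "cut_rest (cut_marking w s c) = cut_right_from w s c"
    and "marked_intervals s (cut_marking w s c) = c"
proof -
  have "map fst (cut_marking w s c) = subword w s (length w + 1) \<and>
    cut_blocks (cut_marking w s c) = cut_left w c \<and>
    cut_rest (cut_marking w s c) = cut_right_from w s c \<and>
    marked_intervals s (cut_marking w s c) = c"
    using assms
  proof (induction w s c rule: cut_marking.induct)
    case (1 w s)
    show ?case
      using marked_intervals_unmarked[of s "subword w s (length w + 1)" "[]"]
      by (simp add: comp_def cut_blocks_def cut_left_def cut_rest_def blocks_none filter_map)
  next
    case (2 w s i j c)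
    let ?u = "map (\<lambda>a. (a, True)) (subword w i j)" and ?v = "cut_marking w j c"
    have ij: "1 \<le> i" "s \<le> i" "i < j" "j \<le> length w + 1" "c \<in> intervals w (Suc j)"
      using 2 by auto
    then have IH: "map fst ?v = subword w j (length w + 1)" "cut_blocks ?v = cut_left w c"
      "cut_rest ?v = cut_right_from w j c" "marked_intervals j ?v = c"
      using 2 intervals_mono[of c w "Suc j" j] by auto
    have len: "length (subword w i j) = j - i" "length (subword w s i) = i - s"
      using 2 ij by (simp_all add: length_subword)
    then have u: "?u \<noteq> []" "\<forall>x\<in>set ?u. snd x" using ij by auto
    have stop: "?v = [] \<or> \<not> snd (hd ?v)" using ij by (intro cut_marking_stop) auto
    have "subword w s i @ subword w i j @ subword w j (length w + 1) = subword w s (length w + 1)"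
      using ij 2 by (simp add: subword_append)
    moreover have "cut_blocks (cut_marking w s ((i, j) # c)) = cut_left w ((i, j) # c)"
      using IH(2) blocks_block[OF u stop]
      by (simp add: cut_blocks_def cut_left_def blocks_none_append comp_def)
    moreover have "marked_intervals s (cut_marking w s ((i, j) # c)) = (i, j) # c"
      using IH(4) ij len marked_intervals_block[OF u stop]
      by (simp add: marked_intervals_unmarked)
    ultimately show ?case using IH by (simp add: comp_def cut_rest_def filter_map)
  qed
  then show "map fst (cut_marking w s c) = subword w s (length w + 1)"
    and "cut_blocks (cut_marking w s c) = cut_left w c"
    and "cut_rest (cut_marking w s c) = cut_right_from w s c"
    and "marked_intervals s (cut_marking w s c) = c" by blast+
qed

text \<open>The sharper bound \<open>Suc s\<close> for an unmarked first letter is what keeps the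
  interval following a run from touching it.\<close>

lemma marked_intervals_mem:
  "1 \<le> s \<Longrightarrow> length b + s = length w + 1 \<Longrightarrow>
    marked_intervals s b \<in> intervals w (if b = [] \<or> snd (hd b) then s else Suc s)"
proof (induction b arbitrary: s rule: blocks_induct[where P = snd])
  case (skip x b)
  then have "marked_intervals (Suc s) b \<in> intervals w (if b = [] \<or> snd (hd b) then Suc s else Suc (Suc s))"
    by auto
  then show ?case using skip.hyps intervals_mono[of _ w "Suc (Suc s)" "Suc s"] by (auto split: if_splits)
next
  case (block u v)
  have "marked_intervals (s + length u) v \<in> intervals w (Suc (s + length u))"
    using block.IH[of "s + length u"] block by (cases "v = []") auto
  then show ?case using block by (auto simp: marked_intervals_block neq_Nil_conv)
qed simp

lemma cut_marking_marked_intervals: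
  "1 \<le> s \<Longrightarrow> s \<le> length w + 1 \<Longrightarrow> map fst b = subword w s (length w + 1) \<Longrightarrow>
    cut_marking w s (marked_intervals s b) = b"
proof (induction b arbitrary: s rule: blocks_induct[where P = snd])
  case Nil
  then show ?case by simp
next
  case (skip x b)
  let ?n = "length w + 1"
  have "length (subword w s ?n) = ?n - s" using skip.prems by (simp add: length_subword)
  then have s: "s < ?n" using skip.prems(3) by (cases "subword w s ?n") auto
  have split: "subword w s t = subword w s (Suc s) @ subword w (Suc s) t" if "Suc s \<le> t" for t
    using skip.prems(1) that by (simp add: subword_append)
  have "length (subword w s (Suc s)) = 1" using skip.prems(1) s by (simp add: length_subword)
  then obtain a where a: "subword w s (Suc s) = [a]" by (auto simp: length_Suc_conv)
  have b: "fst x = a" "map fst b = subword w (Suc s) ?n"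
    using skip.prems(3) split[of ?n] s a by auto
  let ?c = "marked_intervals (Suc s) b"
  have IH: "cut_marking w (Suc s) ?c = b" using skip.IH[of "Suc s"] b(2) s by simp
  have "length b + Suc s = ?n"
    using b(2) s by (metis Suc_leI add.commute le_add_diff_inverse2 length_map length_subword le_refl
        le_add1 plus_1_eq_Suc)
  then have "?c \<in> intervals w (Suc s)"
    using marked_intervals_mem[of "Suc s" b w] intervals_mono[of ?c w "Suc (Suc s)" "Suc s"]
    by (auto split: if_splits)
  \<comment> \<open>All intervals of \<open>?c\<close> start after \<open>s\<close>, so the initial
    unmarked stretch begins with the letter \<open>a\<close> at position \<open>s\<close>.\<close>
  then have "cut_marking w s ?c = (a, False) # cut_marking w (Suc s) ?c"
    using split[of ?n] split[of "fst (hd ?c)"] a s by (cases ?c) auto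
  then show ?case using skip.hyps b IH by (cases x) simp
next
  case (block u v)
  let ?n = "length w + 1" and ?j = "s + length u"
  have "length (subword w s ?n) = ?n - s" using block.prems by (simp add: length_subword)
  then have j: "?j \<le> ?n"
    using arg_cong[OF block.prems(3), of length] block.prems(2) by simp
  have "subword w s ?n = subword w s ?j @ subword w ?j ?n"
    using block.prems j by (simp add: subword_append)
  moreover have "length (subword w s ?j) = length u" using block.prems j by (simp add: length_subword)
  ultimately have *: "map fst u = subword w s ?j" "map fst v = subword w ?j ?n"
    using block.prems(3) by (simp_all add: append_eq_append_conv)
  have "map (\<lambda>a. (a, True)) (subword w s ?j) = u"
    unfolding *(1)[symmetric] map_map using block.hyps(2) by (intro map_idI) (simp add: prod_eq_iff)
  moreover have "cut_marking w ?j (marked_intervals ?j v) = v"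
    using block.IH[of ?j] block.prems j * by simp
  ultimately show ?case using block.hyps by (simp add: marked_intervals_block)
qed

text \<open>The total marking is removed because it belongs to the excluded cut
  \<open>[(1, length w + 1)]\<close>. For the empty word it would coincide with the marking of the
  empty cut.\<close>

lemma bij_betw_cut_marking:
  assumes "w \<noteq> []"
  shows "bij_betw (cut_marking w 1) (cuts L w) (markings L w - {map (\<lambda>a. (a, True)) w})"
proof (rule bij_betw_byWitness[where f' = "marked_intervals 1"])
  let ?t = "map (\<lambda>a. (a, True)) w"
  have full: "cut_marking w 1 [(1, length w + 1)] = ?t"
    using subword_full[of w] by simp
  have all: "b = ?t" if "map fst b = w" "\<forall>x\<in>set b. snd x" for b
    unfolding that(1)[symmetric] map_map using that(2) by (intro map_idI[symmetric]) (simp add: prod_eq_iff)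
  have cm: "cut_marking w 1 (marked_intervals 1 b) = b" if "map fst b = w" for b
    using that subword_full[of w] by (intro cut_marking_marked_intervals) simp_all
  have mi: "marked_intervals 1 b \<in> intervals w 1" if "map fst b = w" for b
    using marked_intervals_mem[of 1 b w] intervals_mono[of _ w "Suc 1" 1] that
    by (auto split: if_splits)
  show "\<forall>c\<in>cuts L w. marked_intervals 1 (cut_marking w 1 c) = c"
    by (auto simp: cuts_intervals intro!: cut_marking(4))
  show "\<forall>b\<in>markings L w - {?t}. cut_marking w 1 (marked_intervals 1 b) = b"
    using cm by (simp add: markings_def)
  show "cut_marking w 1 ` cuts L w \<subseteq> markings L w - {?t}"
  proof (rule image_subsetI)
    fix c assume "c \<in> cuts L w"
    then have c: "c \<in> intervals w 1" "set (cut_left w c) \<subseteq> L" "c \<noteq> [(1, length w + 1)]"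
      by (simp_all add: cuts_intervals)
    \<comment> \<open>Otherwise \<open>marked_intervals\<close> would recover both \<open>c\<close>
      and \<open>[(1, length w + 1)]\<close> from the same marking.\<close>
    have "cut_marking w 1 c \<noteq> ?t"
      using c(3) cut_marking(4)[of 1 w c] cut_marking(4)[of 1 w "[(1, length w + 1)]"] c(1) full assms
      by (auto simp: Suc_le_eq)
    then show "cut_marking w 1 c \<in> markings L w - {?t}"
      using c(1,2) cut_marking(1,2)[of 1 w c] subword_full[of w] by (simp add: markings_def admissible_def)
  qed
  show "marked_intervals 1 ` (markings L w - {?t}) \<subseteq> cuts L w"
  proof (rule image_subsetI)
    fix b assume "b \<in> markings L w - {?t}"
    then have b: "map fst b = w" "set (cut_blocks b) \<subseteq> L" "b \<noteq> ?t"
      using all by (auto simp: markings_def admissible_def)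
    then show "marked_intervals 1 b \<in> cuts L w"
      using full cm[OF b(1)] mi[OF b(1)] cut_marking(2)[of 1 w "marked_intervals 1 b"]
      by (auto simp: cuts_intervals)
  qed
qed

lemma cut_coproduct_markings:
  assumes "w \<noteq> []"
  shows "cut_coproduct L w =
    (\<Sum>b\<in>markings L w. basis (cut_blocks b, phrase_of (cut_rest b)) ::
      _ \<Rightarrow>\<^sub>0 'r::{comm_ring,comm_monoid_mult})"
proof -
  let ?t = "map (\<lambda>a. (a, True)) w" and ?f = "\<lambda>b. basis (cut_blocks b, phrase_of (cut_rest b)) :: _ \<Rightarrow>\<^sub>0 'r"
  have t: "?t \<in> markings L w" by (simp add: markings_def admissible_def comp_def)
  have "?f ?t = tensor (basis [w]) phrase_one"
    using assms blocks_all[of ?t snd]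
    by (simp add: cut_blocks_def cut_rest_def phrase_of_def phrase_one_def comp_def filter_map)
  moreover have "(\<Sum>c\<in>cuts L w. tensor (basis (cut_left w c)) (basis [cut_right w c])) =
      (\<Sum>c\<in>cuts L w. ?f (cut_marking w 1 c))"
  proof (rule sum.cong[OF refl])
    fix c assume c: "c \<in> cuts L w"
    then have "c \<in> intervals w 1" by (simp add: cuts_intervals)
    \<comment> \<open>\<open>r_c(w)\<close> is non-empty for a cut, so \<open>phrase_of\<close>
      makes it a one-word phrase.\<close>
    then show "tensor (basis (cut_left w c)) (basis [cut_right w c]) = ?f (cut_marking w 1 c)"
      using cut_marking(2,3)[of 1 w c] cut_right_nonempty[OF assms c]
      by (simp add: cut_right_def phrase_of_def)
  qed
  ultimately show ?thesis
    unfolding cut_coproduct_def sum.reindex_bij_betw[OF bij_betw_cut_marking[OF assms], of ?f]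
    using sum.remove[OF finite_markings t, of ?f] by simp
qed

section \<open>Antipodes of graded connected bialgebras\<close>

lemma lin_ext_sum: "lin_ext scale f (sum g I) = (\<Sum>i\<in>I. lin_ext scale f (g i))"
  by (induction I rule: infinite_finite_induct) simp_all

lemma bilin_ext_sum:
  "bilin_ext f (sum g I) (sum h J) = (\<Sum>i\<in>I. \<Sum>j\<in>J. bilin_ext f (g i) (h j))"
proof -
  have "bilin_ext f (sum g I) q = (\<Sum>i\<in>I. bilin_ext f (g i) q)" for q
    by (simp add: bilin_ext_def lin_ext_sum)
  moreover have "bilin_ext f p (sum h J) = (\<Sum>j\<in>J. bilin_ext f p (h j))" for p
    by (simp add: bilin_ext_swap lin_ext_sum)
  ultimately have "bilin_ext f (sum g I) (sum h J) = (\<Sum>i\<in>I. bilin_ext f (g i) (sum h J))"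
    "\<And>i. bilin_ext f (g i) (sum h J) = (\<Sum>j\<in>J. bilin_ext f (g i) (h j))" by blast+
  then show ?thesis by simp
qed

lemma scale_0 [simp]: "scale 0 p = (0 :: 'b \<Rightarrow>\<^sub>0 'r::{comm_ring,comm_monoid_mult})"
  by (rule poly_mapping_eqI) simp

lemma lin_ext_cong:
  "u \<in> free_module C \<Longrightarrow> (\<And>z. z \<in> C \<Longrightarrow> f z = g z) \<Longrightarrow> lin_ext s f u = lin_ext s g u"
  unfolding lin_ext_def free_module_def by (rule sum.cong) auto

lemma lin_ext_lin_ext:
  "lin_ext scale f (lin_ext scale g u) = lin_ext scale (\<lambda>z. lin_ext scale f (g z)) u"
  unfolding lin_ext_def[of scale g] lin_ext_sum by (simp add: lin_ext_def[of _ _ u])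

lemma lin_ext_fun_add:
  "lin_ext scale (\<lambda>z. f z + g z) u = lin_ext scale f u + lin_ext scale g u"
  by (simp add: lin_ext_def sum.distrib)

lemma linear_on_comp_lin_ext:
  assumes F: "linear_on (free_module B) scale N scale F"
    and u: "u \<in> free_module C" and g: "\<And>z. z \<in> C \<Longrightarrow> g z \<in> free_module B"
  shows "F (lin_ext scale g u) = lin_ext scale (\<lambda>z. F (g z)) u"
proof (rule linear_on_eqI[OF _ _ _ u, where f = "\<lambda>u. F (lin_ext scale g u)"])
  show "linear_on (free_module C) scale UNIV scale (\<lambda>u. F (lin_ext scale g u))"
    using F g by (auto simp: linear_on_def lin_ext_in)
  show "linear_on (free_module C) scale UNIV scale (lin_ext scale (\<lambda>z. F (g z)))"
    by (auto simp: linear_on_def)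
qed simp

lemma linear_on_lin_ext_comp:
  assumes "linear_on (free_module B) scale N scale F"
  shows "linear_on (free_module B) scale UNIV scale (\<lambda>p. lin_ext scale g (F p))"
  using assms by (auto simp: linear_on_def)

text \<open>Multiplicativity is checked on basis elements. Three maps \<open>f\<close>,
  \<open>g\<close>, \<open>h\<close> are allowed since in the application each one carries its own
  fixed phrase in one tensor factor, that of \<open>f\<close> being the concatenation of the other
  two.\<close>

lemma bilin_ext_hom:
  assumes "\<And>x y. x \<in> B \<Longrightarrow> y \<in> C \<Longrightarrow> f (m x y) = bilin_ext m' (g x) (h y)"
    and "p \<in> free_module B" "q \<in> free_module C"
  shows "lin_ext scale f (bilin_ext (\<lambda>x y. basis (m x y)) p q) =
    bilin_ext m' (lin_ext scale g p) (lin_ext scale h q)"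
proof (rule linear_on_eqI[OF _ _ _ assms(2),
    where f = "\<lambda>p. lin_ext scale f (bilin_ext (\<lambda>x y. basis (m x y)) p q)"])
  show "linear_on (free_module B) scale UNIV scale
      (\<lambda>p. lin_ext scale f (bilin_ext (\<lambda>x y. basis (m x y)) p q))"
    "linear_on (free_module B) scale UNIV scale
      (\<lambda>p. bilin_ext m' (lin_ext scale g p) (lin_ext scale h q))"
    by (auto simp: linear_on_def bilin_ext_simps)
  fix x assume x: "x \<in> B"
  show "lin_ext scale f (bilin_ext (\<lambda>x y. basis (m x y)) (basis x) q) =
    bilin_ext m' (lin_ext scale g (basis x)) (lin_ext scale h q)"
  proof (rule linear_on_eqI[OF _ _ _ assms(3),
      where f = "\<lambda>q. lin_ext scale f (bilin_ext (\<lambda>x y. basis (m x y)) (basis x) q)"])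
    show "linear_on (free_module C) scale UNIV scale
        (\<lambda>q. lin_ext scale f (bilin_ext (\<lambda>x y. basis (m x y)) (basis x) q))"
      "linear_on (free_module C) scale UNIV scale
        (\<lambda>q. bilin_ext m' (lin_ext scale g (basis x)) (lin_ext scale h q))"
      by (auto simp: linear_on_def bilin_ext_simps)
  qed (use x assms(1) in simp)
qed

lemma tensor_basis_right: "tensor p (basis z) = lin_ext scale (\<lambda>x. basis (x, z)) p"
  by (simp add: tensor_def bilin_ext_def)

lemma tensor_basis_left: "tensor (basis x) q = lin_ext scale (\<lambda>z. basis (x, z)) q"
  by (simp add: tensor_def bilin_ext_def)

lemma mult_map_tensor:
  assumes mul: "bilinear_on (free_module B) scale (free_module B) scale (free_module B) scale mul"
    and p: "p \<in> free_module B" and q: "q \<in> free_module B"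
  shows "mult_map mul (tensor p q) = mul p q"
proof (rule linear_on_eqI[OF _ _ _ p, where f = "\<lambda>p. mult_map mul (tensor p q)"])
  show "linear_on (free_module B) scale UNIV scale (\<lambda>p. mult_map mul (tensor p q))"
    by (auto simp: linear_on_def mult_map_def tensor_def bilin_ext_simps)
  show "linear_on (free_module B) scale (free_module B) scale (\<lambda>p. mul p q)"
    using mul q by (simp add: bilinear_on_def)
  fix x assume x: "x \<in> B"
  show "mult_map mul (tensor (basis x) q) = mul (basis x) q"
  proof (rule linear_on_eqI[OF _ _ _ q, where f = "\<lambda>q. mult_map mul (tensor (basis x) q)"])
    show "linear_on (free_module B) scale UNIV scale (\<lambda>q. mult_map mul (tensor (basis x) q))"
      by (auto simp: linear_on_def mult_map_def tensor_def bilin_ext_simps)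
    show "linear_on (free_module B) scale (free_module B) scale (\<lambda>q. mul (basis x) q)"
      using mul x by (simp add: bilinear_on_def free_module_basis)
  qed (simp add: mult_map_def)
qed

text \<open>The convolution product, first \<Delta>, then f \<otimes> g, then \<open>mul\<close>.
  The linear maps are represented by their values on the basis, so that they can be defined by
  recursion on the degree.\<close>

definition convolution ::
  "(('b \<Rightarrow>\<^sub>0 'r) \<Rightarrow> ('b \<Rightarrow>\<^sub>0 'r) \<Rightarrow> 'b \<Rightarrow>\<^sub>0 'r) \<Rightarrow>
   (('b \<Rightarrow>\<^sub>0 'r::{comm_ring,comm_monoid_mult}) \<Rightarrow> ('b \<times> 'b \<Rightarrow>\<^sub>0 'r)) \<Rightarrow>
   ('b \<Rightarrow> 'b \<Rightarrow>\<^sub>0 'r) \<Rightarrow> ('b \<Rightarrow> 'b \<Rightarrow>\<^sub>0 'r) \<Rightarrow> 'b \<Rightarrow> 'b \<Rightarrow>\<^sub>0 'r"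
  where "convolution mul \<Delta> f g x = lin_ext scale (\<lambda>(y, z). mul (f y) (g z)) (\<Delta> (basis x))"

locale free_coalgebra =
  fixes B :: "'b set"
    and mul :: "('b \<Rightarrow>\<^sub>0 'r::{comm_ring,comm_monoid_mult}) \<Rightarrow> ('b \<Rightarrow>\<^sub>0 'r) \<Rightarrow> 'b \<Rightarrow>\<^sub>0 'r"
    and one :: "'b \<Rightarrow>\<^sub>0 'r"
    and \<Delta> :: "('b \<Rightarrow>\<^sub>0 'r) \<Rightarrow> ('b \<times> 'b \<Rightarrow>\<^sub>0 'r)"
  assumes algebra: "unital_algebra B mul one"
    and linear: "linear_on (free_module B) scale (free_module (B \<times> B)) scale \<Delta>"
    and coassoc: "coassociative B \<Delta>"
begin

lemma mul_bilinear: "bilinear_on (free_module B) scale (free_module B) scale (free_module B) scale mul"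
  and one_in: "one \<in> free_module B"
  and mul_assoc: "p \<in> free_module B \<Longrightarrow> q \<in> free_module B \<Longrightarrow> r \<in> free_module B \<Longrightarrow>
    mul (mul p q) r = mul p (mul q r)"
  and mul_one: "p \<in> free_module B \<Longrightarrow> mul one p = p" "p \<in> free_module B \<Longrightarrow> mul p one = p"
  using algebra by (auto simp: unital_algebra_def Let_def)

lemma mul_linear:
  assumes "q \<in> free_module B"
  shows "linear_on (free_module B) scale (free_module B) scale (\<lambda>p. mul p q)"
    "linear_on (free_module B) scale (free_module B) scale (mul q)"
  using mul_bilinear assms by (auto simp: bilinear_on_def)

lemma mul_in: "p \<in> free_module B \<Longrightarrow> q \<in> free_module B \<Longrightarrow> mul p q \<in> free_module B"
  using mul_linear(2)[of p] by (simp add: linear_on_def)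

lemma mul_scale:
  "p \<in> free_module B \<Longrightarrow> q \<in> free_module B \<Longrightarrow> mul (scale c p) q = scale c (mul p q)"
  "p \<in> free_module B \<Longrightarrow> q \<in> free_module B \<Longrightarrow> mul p (scale c q) = scale c (mul p q)"
  using mul_linear[of q] mul_linear[of p] by (simp_all add: linear_on_def)

lemma coproduct_in: "x \<in> B \<Longrightarrow> \<Delta> (basis x) \<in> free_module (B \<times> B)"
  using linear by (simp add: linear_on_def free_module_basis)

lemma convolution_cong:
  assumes "x \<in> B" "\<And>y. y \<in> B \<Longrightarrow> f y = f' y" "\<And>y. y \<in> B \<Longrightarrow> g y = g' y"
  shows "convolution mul \<Delta> f g x = convolution mul \<Delta> f' g' x"
  unfolding convolution_def by (rule lin_ext_cong[OF coproduct_in]) (use assms in auto)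

text \<open>Each side is the triple product \<open>m3\<close> applied to one side of the
  coassociativity law at \<open>x\<close>; associativity of \<open>mul\<close> fixes the
  bracketing.\<close>

lemma convolution_assoc:
  assumes fgh: "\<And>x. x \<in> B \<Longrightarrow> f x \<in> free_module B" "\<And>x. x \<in> B \<Longrightarrow> g x \<in> free_module B"
      "\<And>x. x \<in> B \<Longrightarrow> h x \<in> free_module B"
    and x: "x \<in> B"
  shows "convolution mul \<Delta> (convolution mul \<Delta> f g) h x =
    convolution mul \<Delta> f (convolution mul \<Delta> g h) x"
proof -
  define m3 where "m3 = lin_ext scale (\<lambda>(x, y, z). mul (f x) (mul (g y) (h z)))"
  have left: "mul (convolution mul \<Delta> f g y) (h z) =
      m3 (tensor_assoc (tensor (\<Delta> (basis y)) (basis z)))" if "y \<in> B" "z \<in> B" for y z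
  proof -
    have "mul (convolution mul \<Delta> f g y) (h z) =
        lin_ext scale (\<lambda>u. mul (case u of (a, b) \<Rightarrow> mul (f a) (g b)) (h z)) (\<Delta> (basis y))"
      unfolding convolution_def
      by (rule linear_on_comp_lin_ext[OF mul_linear(1) coproduct_in]) (use that fgh mul_in in auto)
    also have "\<dots> = lin_ext scale (\<lambda>(a, b). mul (f a) (mul (g b) (h z))) (\<Delta> (basis y))"
      by (rule lin_ext_cong[OF coproduct_in]) (use that fgh mul_assoc in auto)
    finally show ?thesis
      by (simp add: tensor_basis_right tensor_assoc_def m3_def lin_ext_lin_ext case_prod_unfold)
  qed
  have right: "mul (f y) (convolution mul \<Delta> g h z) = m3 (tensor (basis y) (\<Delta> (basis z)))"
    if "y \<in> B" "z \<in> B" for y z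
  proof -
    have "mul (f y) (convolution mul \<Delta> g h z) =
        lin_ext scale (\<lambda>u. mul (f y) (case u of (a, b) \<Rightarrow> mul (g a) (h b))) (\<Delta> (basis z))"
      unfolding convolution_def
      by (rule linear_on_comp_lin_ext[OF mul_linear(2) coproduct_in]) (use that fgh mul_in in auto)
    then show ?thesis
      by (simp add: tensor_basis_left m3_def lin_ext_lin_ext case_prod_unfold)
  qed
  have "convolution mul \<Delta> (convolution mul \<Delta> f g) h x =
      lin_ext scale (\<lambda>(y, z). m3 (tensor_assoc (tensor (\<Delta> (basis y)) (basis z)))) (\<Delta> (basis x))"
    unfolding convolution_def[of _ _ _ h] by (rule lin_ext_cong[OF coproduct_in[OF x]]) (use left in auto)
  also have "\<dots> = m3 (tensor_assoc (tensor_map \<Delta> id (\<Delta> (basis x))))"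
    by (simp add: m3_def tensor_assoc_def tensor_map_def lin_ext_lin_ext case_prod_unfold)
  also have "\<dots> = m3 (tensor_map id \<Delta> (\<Delta> (basis x)))"
    using coassoc x by (simp add: coassociative_def free_module_basis)
  also have "\<dots> = lin_ext scale (\<lambda>(y, z). m3 (tensor (basis y) (\<Delta> (basis z)))) (\<Delta> (basis x))"
    by (simp add: m3_def tensor_map_def lin_ext_lin_ext case_prod_unfold)
  also have "\<dots> = convolution mul \<Delta> f (convolution mul \<Delta> g h) x"
    unfolding convolution_def[of _ _ f] by (rule lin_ext_cong[OF coproduct_in[OF x]]) (use right in auto)
  finally show ?thesis .
qed

end

text \<open>\<open>K f x\<close> depends on \<open>f\<close> only below the degree of
  \<open>x\<close>, so well-founded recursion yields a fixed point on \<open>B\<close>;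
  \<open>closed\<close> then gives values in \<open>M\<close> by induction on the degree.\<close>

lemma graded_recursion:
  fixes deg :: "'b \<Rightarrow> nat" and K :: "('b \<Rightarrow> 'm) \<Rightarrow> 'b \<Rightarrow> 'm"
  assumes cong: "\<And>f g x. x \<in> B \<Longrightarrow> (\<And>y. y \<in> B \<Longrightarrow> deg y < deg x \<Longrightarrow> f y = g y) \<Longrightarrow> K f x = K g x"
    and closed: "\<And>f x. x \<in> B \<Longrightarrow> (\<And>y. y \<in> B \<Longrightarrow> deg y < deg x \<Longrightarrow> f y \<in> M) \<Longrightarrow> K f x \<in> M"
  shows "\<exists>f. \<forall>x\<in>B. f x = K f x \<and> f x \<in> M"
proof -
  \<comment> \<open>\<open>cong\<close> speaks only of arguments in \<open>B\<close>; the constant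
    value elsewhere makes the functional admissible everywhere.\<close>
  let ?r = "measure deg" and ?K = "\<lambda>f x. if x \<in> B then K f x else undefined"
  define f where "f = wfrec ?r ?K"
  have "adm_wf ?r ?K"
    unfolding adm_wf_def
  proof (intro allI impI)
    fix f g :: "'b \<Rightarrow> 'm" and x
    assume "\<forall>z. (z, x) \<in> ?r \<longrightarrow> f z = g z"
    then show "?K f x = ?K g x" using cong[of x f g] by simp
  qed
  then have "f = ?K f"
    unfolding f_def by (rule wfrec_fixpoint[OF wf_measure])
  then have "f x = ?K f x" for x
    by (rule fun_cong)
  then have f: "f x = K f x" if "x \<in> B" for x
    by (rule trans) (simp add: that)
  have "f x \<in> M" if "x \<in> B" for x
    using that
  proof (induction "deg x" arbitrary: x rule: less_induct)
    case less
    then have "K f x \<in> M" by (intro closed) auto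
    then show ?case using f[OF less.prems] by simp
  qed
  with f show ?thesis by blast
qed

text \<open>
  In the recursions below, the terms of the coproduct omitted by the conditions \<open>z = e\<close> and \<open>y = e\<close>
  add up to \<open>S x\<close> and \<open>T x\<close> by the counit laws, so no separate case for \<open>x = e\<close> is needed.
\<close>

theorem (in free_coalgebra) graded_antipode:
  fixes deg :: "'b \<Rightarrow> nat" and \<epsilon> :: "('b \<Rightarrow>\<^sub>0 'r) \<Rightarrow> 'r"
  assumes counit: "is_counit B mul one \<Delta> \<epsilon>"
    and counit_basis: "\<And>x. x \<in> B \<Longrightarrow> \<epsilon> (basis x) = (if x = e then 1 else 0)"
    and one: "one = basis e"
    and connected: "\<And>x. x \<in> B \<Longrightarrow> deg x = 0 \<Longrightarrow> x = e"
    and graded: "\<And>x. x \<in> B \<Longrightarrow>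
      \<Delta> (basis x) \<in> free_module {(y, z). y \<in> B \<and> z \<in> B \<and> deg y + deg z = deg x}"
  shows "\<exists>S. is_antipode B mul one \<Delta> \<epsilon> S"
proof -
  note fb = free_module_basis
  have cu: "lin_ext scale (\<lambda>(y, z). scale (\<epsilon> (basis y)) (basis z)) (\<Delta> (basis x)) = basis x"
    "lin_ext scale (\<lambda>(y, z). scale (\<epsilon> (basis z)) (basis y)) (\<Delta> (basis x)) = basis x" if "x \<in> B" for x
    using counit that by (simp_all add: is_counit_def fb)
  \<comment> \<open>The linear extension of \<open>f\<close> is applied to both sides of the counit
    laws.\<close>
  have cu_left: "lin_ext scale (\<lambda>(y, z). scale (\<epsilon> (basis y)) (f z)) (\<Delta> (basis x)) = f x"
    and cu_right: "lin_ext scale (\<lambda>(y, z). scale (\<epsilon> (basis z)) (f y)) (\<Delta> (basis x)) = f x"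
    if "x \<in> B" for f :: "'b \<Rightarrow> 'b \<Rightarrow>\<^sub>0 'r" and x
    using cu[OF that, THEN arg_cong, of "lin_ext scale f"]
    by (simp_all add: lin_ext_lin_ext case_prod_unfold)
  let ?unit = "\<lambda>x. scale (\<epsilon> (basis x)) one"
  have sub: "p - q \<in> free_module B" if "p \<in> free_module B" "q \<in> free_module B" for p q :: "'b \<Rightarrow>\<^sub>0 'r"
    using keys_diff[of p q] that by (auto simp: free_module_def)
  let ?KS = "\<lambda>S x. ?unit x -
    lin_ext scale (\<lambda>(y, z). if z = e then 0 else mul (S y) (basis z)) (\<Delta> (basis x))"
  let ?KT = "\<lambda>T x. ?unit x -
    lin_ext scale (\<lambda>(y, z). if y = e then 0 else mul (basis y) (T z)) (\<Delta> (basis x))"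
  have "\<exists>S. \<forall>x\<in>B. S x = ?KS S x \<and> S x \<in> free_module B"
  proof (rule graded_recursion[of B deg ?KS "free_module B"])
    fix f g :: "'b \<Rightarrow> 'b \<Rightarrow>\<^sub>0 'r" and x
    assume x: "x \<in> B"
    \<comment> \<open>If \<open>z \<noteq> e\<close> then \<open>deg z > 0\<close> by connectedness,
      hence \<open>deg y < deg x\<close> by the grading.\<close>
    show "?KS f x = ?KS g x" if "\<And>y. y \<in> B \<Longrightarrow> deg y < deg x \<Longrightarrow> f y = g y"
      by (intro arg_cong2[of _ _ _ _ "(-)"] refl lin_ext_cong[OF graded[OF x]])
        (use that connected in fastforce)
    show "?KS f x \<in> free_module B" if "\<And>y. y \<in> B \<Longrightarrow> deg y < deg x \<Longrightarrow> f y \<in> free_module B"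
      by (intro sub free_module_scale one_in lin_ext_in[OF graded[OF x]])
        (use that connected in \<open>fastforce intro: mul_in fb\<close>)
  qed
  then obtain S where S: "\<And>x. x \<in> B \<Longrightarrow> S x = ?KS S x" "\<And>x. x \<in> B \<Longrightarrow> S x \<in> free_module B"
    by blast
  have "\<exists>T. \<forall>x\<in>B. T x = ?KT T x \<and> T x \<in> free_module B"
  proof (rule graded_recursion[of B deg ?KT "free_module B"])
    fix f g :: "'b \<Rightarrow> 'b \<Rightarrow>\<^sub>0 'r" and x
    assume x: "x \<in> B"
    show "?KT f x = ?KT g x" if "\<And>y. y \<in> B \<Longrightarrow> deg y < deg x \<Longrightarrow> f y = g y"
      by (intro arg_cong2[of _ _ _ _ "(-)"] refl lin_ext_cong[OF graded[OF x]])
        (use that connected in fastforce)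
    show "?KT f x \<in> free_module B" if "\<And>y. y \<in> B \<Longrightarrow> deg y < deg x \<Longrightarrow> f y \<in> free_module B"
      by (intro sub free_module_scale one_in lin_ext_in[OF graded[OF x]])
        (use that connected in \<open>fastforce intro: mul_in fb\<close>)
  qed
  then obtain T where T: "\<And>x. x \<in> B \<Longrightarrow> T x = ?KT T x" "\<And>x. x \<in> B \<Longrightarrow> T x \<in> free_module B"
    by blast
  have inv_left: "convolution mul \<Delta> S basis x = ?unit x" if x: "x \<in> B" for x
  proof -
    let ?f = "\<lambda>(y, z). if z = e then 0 else mul (S y) (basis z)"
    \<comment> \<open>At \<open>z = e\<close> the product is \<open>S y\<close>, which is the counit
      summand there; at every other \<open>z\<close> the counit vanishes.\<close>
    have "convolution mul \<Delta> S basis x =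
        lin_ext scale (\<lambda>u. ?f u + (\<lambda>(y, z). scale (\<epsilon> (basis z)) (S y)) u) (\<Delta> (basis x))"
      unfolding convolution_def
      by (rule lin_ext_cong[OF coproduct_in[OF x]]) (auto simp: counit_basis mul_one S(2) simp flip: one)
    also have "\<dots> = lin_ext scale ?f (\<Delta> (basis x)) + S x"
      unfolding lin_ext_fun_add cu_right[OF x] ..
    also have "\<dots> = ?unit x" using S(1)[OF x] by (simp add: eq_diff_eq add.commute)
    finally show ?thesis .
  qed
  have inv_right: "convolution mul \<Delta> basis T x = ?unit x" if x: "x \<in> B" for x
  proof -
    let ?f = "\<lambda>(y, z). if y = e then 0 else mul (basis y) (T z)"
    have "convolution mul \<Delta> basis T x =
        lin_ext scale (\<lambda>u. ?f u + (\<lambda>(y, z). scale (\<epsilon> (basis y)) (T z)) u) (\<Delta> (basis x))"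
      unfolding convolution_def
      by (rule lin_ext_cong[OF coproduct_in[OF x]]) (auto simp: counit_basis mul_one T(2) simp flip: one)
    also have "\<dots> = lin_ext scale ?f (\<Delta> (basis x)) + T x"
      unfolding lin_ext_fun_add cu_left[OF x] ..
    also have "\<dots> = ?unit x" using T(1)[OF x] by (simp add: eq_diff_eq add.commute)
    finally show ?thesis .
  qed
  \<comment> \<open>\<open>S\<close> and \<open>T\<close> are a left and a right inverse of
    \<open>basis\<close>, and \<open>?unit\<close> is neutral for convolution.\<close>
  have ST: "S x = T x" if x: "x \<in> B" for x
  proof -
    have "T x = convolution mul \<Delta> ?unit T x"
      unfolding convolution_def cu_left[OF x, of T, symmetric]
      by (rule lin_ext_cong[OF coproduct_in[OF x]]) (auto simp: mul_scale mul_one one_in T(2))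
    also have "\<dots> = convolution mul \<Delta> (convolution mul \<Delta> S basis) T x"
      by (rule convolution_cong[OF x]) (simp_all add: inv_left)
    also have "\<dots> = convolution mul \<Delta> S (convolution mul \<Delta> basis T) x"
      by (rule convolution_assoc) (simp_all add: S(2) T(2) fb x)
    also have "\<dots> = convolution mul \<Delta> S ?unit x"
      by (rule convolution_cong[OF x]) (simp_all add: inv_right)
    also have "\<dots> = S x"
      unfolding convolution_def cu_right[OF x, of S, symmetric]
      by (rule lin_ext_cong[OF coproduct_in[OF x]]) (auto simp: mul_scale mul_one one_in S(2))
    finally show ?thesis by simp
  qed
  have lin_unit: "linear_on (free_module B) scale UNIV scale (\<lambda>p :: 'b \<Rightarrow>\<^sub>0 'r. scale (\<epsilon> p) one)"
    using counit module_scale_scale by (auto simp: is_counit_def linear_on_def module_scale_def)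
  let ?S = "lin_ext scale S"
  have lin: "linear_on (free_module B) scale UNIV scale (\<lambda>p. mult_map mul (tensor_map f g (\<Delta> p)))"
    for f g :: "('b \<Rightarrow>\<^sub>0 'r) \<Rightarrow> 'b \<Rightarrow>\<^sub>0 'r"
    using linear by (auto simp: linear_on_def mult_map_def tensor_map_def)
  have mm: "mult_map mul (tensor_map f g (\<Delta> (basis x))) =
      convolution mul \<Delta> (\<lambda>y. f (basis y)) (\<lambda>y. g (basis y)) x"
    if "x \<in> B" "\<And>y. y \<in> B \<Longrightarrow> f (basis y) \<in> free_module B" "\<And>y. y \<in> B \<Longrightarrow> g (basis y) \<in> free_module B"
    for f g x
  proof -
    have "mult_map mul (tensor_map f g (\<Delta> (basis x))) =
        lin_ext scale (\<lambda>(y, z). mult_map mul (tensor (f (basis y)) (g (basis z)))) (\<Delta> (basis x))"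
      by (simp add: mult_map_def tensor_map_def lin_ext_lin_ext case_prod_unfold)
    also have "\<dots> = convolution mul \<Delta> (\<lambda>y. f (basis y)) (\<lambda>y. g (basis y)) x"
      unfolding convolution_def
      by (rule lin_ext_cong[OF coproduct_in]) (use that in \<open>auto simp: mult_map_tensor[OF mul_bilinear]\<close>)
    finally show ?thesis .
  qed
  have "is_antipode B mul one \<Delta> \<epsilon> ?S"
    unfolding is_antipode_def
  proof (intro conjI ballI)
    show "linear_on (free_module B) scale (free_module B) scale ?S"
      by (auto simp: linear_on_def intro: lin_ext_in S(2))
    fix p :: "'b \<Rightarrow>\<^sub>0 'r" assume p: "p \<in> free_module B"
    show "mult_map mul (tensor_map ?S id (\<Delta> p)) = scale (\<epsilon> p) one"
    proof (rule linear_on_eqI[OF lin lin_unit _ p])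
      fix x assume "x \<in> B"
      then show "mult_map mul (tensor_map ?S id (\<Delta> (basis x))) = ?unit x"
        using inv_left[of x] mm[of x ?S id] by (simp add: S(2) fb)
    qed
    show "mult_map mul (tensor_map id ?S (\<Delta> p)) = scale (\<epsilon> p) one"
    proof (rule linear_on_eqI[OF lin lin_unit _ p])
      fix x assume x: "x \<in> B"
      have "convolution mul \<Delta> basis S x = convolution mul \<Delta> basis T x"
        by (rule convolution_cong[OF x]) (simp_all add: ST)
      then show "mult_map mul (tensor_map id ?S (\<Delta> (basis x))) = ?unit x"
        using x inv_right[of x] mm[of x id ?S] by (simp add: S(2) fb)
    qed
  qed
  then show ?thesis by (rule exI[of _ ?S])
qed

section \<open>The bialgebra of phrases\<close>

text \<open>The term of the coproduct of a phrase that belongs to one chosen marking of each of its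
  words: the product of the terms of the words.\<close>

definition phrase_term :: "('a \<times> bool) list list \<Rightarrow> 'a list list \<times> 'a list list"
  where "phrase_term X = (concat (map cut_blocks X), concat (map (\<lambda>b. phrase_of (cut_rest b)) X))"

lemma bij_betw_phrase_markings_Cons:
  "bij_betw (\<lambda>(b, X). b # X) (markings L w \<times> phrase_markings L x) (phrase_markings L (w # x))"
  by (rule bij_betw_imageI) (auto simp: inj_on_def image_iff markings_def phrase_markings_def)

text \<open>Multiplicativity turns the coproduct of a phrase into a product of the sums from
  \<open>cut_coproduct_markings\<close>, which is expanded word by word.\<close>

lemma cut_comultiplication_phrase:
  fixes \<Delta> :: "('a list list \<Rightarrow>\<^sub>0 'r::{comm_ring,comm_monoid_mult}) \<Rightarrow> _"
  assumes \<Delta>: "cut_comultiplication A L \<Delta>" and "x \<in> phrases A"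
  shows "\<Delta> (basis x) = (\<Sum>X\<in>phrase_markings L x. basis (phrase_term X))"
  using assms(2)
proof (induction x)
  case Nil
  have "phrase_markings L [] = {[]}" by (auto simp: phrase_markings_def)
  then show ?case
    using \<Delta> by (simp add: cut_comultiplication_def tensor_algebra_hom_def algebra_hom_def
        phrase_one_def phrase_term_def)
next
  case (Cons w x)
  then have w: "w \<in> words A" and x: "x \<in> phrases A" by (auto simp: phrases_def)
  have "\<Delta> (basis (w # x)) = \<Delta> (phrase_mult (basis [w]) (basis x))"
    by (simp add: phrase_mult_def)
  also have "\<dots> = tensor_mult phrase_mult (\<Delta> (basis [w])) (\<Delta> (basis x))"
    using \<Delta> w x by (simp add: cut_comultiplication_def tensor_algebra_hom_def algebra_hom_def
        free_module_basis phrases_def)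
  also have "\<dots> = tensor_mult phrase_mult (\<Sum>b\<in>markings L w. basis (cut_blocks b, phrase_of (cut_rest b)))
      (\<Sum>X\<in>phrase_markings L x. basis (phrase_term X))"
    using \<Delta> w by (simp add: cut_comultiplication_def cut_coproduct_markings words_def Cons.IH[OF x])
  also have "\<dots> = (\<Sum>(b, X)\<in>markings L w \<times> phrase_markings L x. basis (phrase_term (b # X)))"
    unfolding tensor_mult_phrase_mult bilin_ext_sum sum.cartesian_product
    by (simp add: phrase_term_def)
  also have "\<dots> = (\<Sum>X\<in>phrase_markings L (w # x). basis (phrase_term X))"
    unfolding sum.reindex_bij_betw[OF bij_betw_phrase_markings_Cons, symmetric]
    by (simp add: case_prod_unfold)
  finally show ?case .
qed

section \<open>Phrases and letter counts in the terms of the coproduct\<close>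

lemma cut_rest_in: "map fst b \<in> lists A \<Longrightarrow> cut_rest b \<in> lists A"
  by (auto simp: cut_rest_def)

lemma cut_blocks_in:
  assumes "map fst b \<in> lists A"
  shows "cut_blocks b \<in> phrases A"
proof -
  have "map fst u \<in> words A" if "u \<in> set (blocks snd b)" for u
    using set_blocks[OF that] assms by (fastforce simp: words_def)
  then show ?thesis by (auto simp: cut_blocks_def phrases_def)
qed

lemma phrase_of_in: "w \<in> lists A \<Longrightarrow> phrase_of w \<in> phrases A"
  by (auto simp: phrase_of_def phrases_def words_def)

lemma length_cut: "length (concat (cut_blocks b)) + length (cut_rest b) = length b"
  using length_concat_blocks[of snd b]
  by (simp add: cut_blocks_def cut_rest_def flip: map_concat)

lemma length_phrase_term:
  "length (concat (fst (phrase_term X))) + length (concat (snd (phrase_term X))) =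
    length (concat X)"
proof (induction X)
  case (Cons b X)
  have "concat (phrase_of (cut_rest b)) = cut_rest b" by (simp add: phrase_of_def)
  then show ?case using Cons length_cut[of b] by (simp add: phrase_term_def)
qed (simp add: phrase_term_def)

lemma phrase_term_in:
  assumes "X \<in> phrase_markings L x" "x \<in> phrases A"
  shows "fst (phrase_term X) \<in> phrases A" "snd (phrase_term X) \<in> phrases A"
proof -
  have "map fst b \<in> lists A" if "b \<in> set X" for b
    using that assms by (auto simp: phrase_markings_def phrases_def words_def)
  then have "cut_blocks b \<in> phrases A" "phrase_of (cut_rest b) \<in> phrases A" if "b \<in> set X" for b
    using that by (simp_all add: cut_blocks_in phrase_of_in cut_rest_in del: in_lists_conv_set)
  then show "fst (phrase_term X) \<in> phrases A" "snd (phrase_term X) \<in> phrases A"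
    by (auto simp: phrase_term_def phrases_def in_lists_conv_set Ball_def)
qed

section \<open>Terms with an empty tensor factor\<close>

lemma cut_blocks_eq_Nil: "cut_blocks b = [] \<longleftrightarrow> b = map (\<lambda>a. (a, False)) (map fst b)"
proof (induction b rule: blocks_induct[where P = snd])
  case (block u v)
  then show ?case
    using blocks_block[of u snd v] by (cases u) (auto simp: cut_blocks_def)
qed (auto simp: cut_blocks_def)

lemma cut_rest_eq_Nil: "cut_rest b = [] \<longleftrightarrow> b = map (\<lambda>a. (a, True)) (map fst b)"
  by (induction b) (auto simp: cut_rest_def)

text \<open>The counit on the left factor keeps only these terms. The form of an equation for
  \<open>X\<close> lets the sum over the markings collapse to one summand.\<close>

lemma fst_phrase_term_eq_Nil:
  "fst (phrase_term X) = [] \<longleftrightarrow> X = map (map (\<lambda>a. (a, False))) (map (map fst) X)"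
proof (induction X)
  case (Cons b X)
  then show ?case using cut_blocks_eq_Nil[of b] by (simp add: phrase_term_def)
qed (simp add: phrase_term_def)

lemma snd_phrase_term_eq_Nil:
  "snd (phrase_term X) = [] \<longleftrightarrow> X = map (map (\<lambda>a. (a, True))) (map (map fst) X)"
proof (induction X)
  case (Cons b X)
  then show ?case using cut_rest_eq_Nil[of b] by (simp add: phrase_term_def phrase_of_def)
qed (simp add: phrase_term_def)

text \<open>\<open>phrase_of\<close> would drop an empty word, so the phrase is recovered when all
  its words are non-empty.\<close>

lemma phrase_term_unmarked:
  assumes "[] \<notin> set x"
  shows "phrase_term (map (map (\<lambda>a. (a, False))) x) = ([], x)"
  using assms
proof (induction x)
  case (Cons w x)
  then have "w \<noteq> []" by auto
  with Cons show ?case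
    by (simp add: phrase_term_def cut_blocks_def cut_rest_def phrase_of_def blocks_none filter_map comp_def)
qed (simp add: phrase_term_def)

lemma phrase_term_marked:
  assumes "[] \<notin> set x"
  shows "phrase_term (map (map (\<lambda>a. (a, True))) x) = (x, [])"
  using assms
proof (induction x)
  case (Cons w x)
  then have "w \<noteq> []" by auto
  with Cons show ?case
    by (simp add: phrase_term_def cut_blocks_def cut_rest_def phrase_of_def blocks_all filter_map comp_def)
qed (simp add: phrase_term_def)

text \<open>Unmarked words have no runs and satisfy the first alternative of
  \<open>admissible\<close>; totally marked words satisfy the second.\<close>

lemma monochrome_markings:
  "map (map (\<lambda>a. (a, m))) x \<in> phrase_markings L x"
  by (cases m) (auto simp: phrase_markings_def admissible_def cut_blocks_def blocks_none comp_def)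

lemma nil_notin_phrase: "x \<in> phrases A \<Longrightarrow> [] \<notin> set x"
  by (auto simp: phrases_def words_def)

section \<open>Coassociativity\<close>

lemma coassociative_words:
  fixes \<Delta> :: "('a list list \<Rightarrow>\<^sub>0 'r::{comm_ring,comm_monoid_mult}) \<Rightarrow> _"
  assumes "stable A L" and \<Delta>: "cut_comultiplication A L \<Delta>" and w: "w \<in> words A"
  shows "tensor_assoc (tensor_map \<Delta> id (\<Delta> (basis [w]))) = tensor_map id \<Delta> (\<Delta> (basis [w]))"
proof -
  have w': "w \<in> lists A" "w \<noteq> []" using w by (auto simp: words_def)
  have dw: "\<Delta> (basis [w]) = (\<Sum>b\<in>markings L w. basis (cut_blocks b, phrase_of (cut_rest b)))"
    using \<Delta> w w'(2) by (simp add: cut_comultiplication_def cut_coproduct_markings)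
  \<comment> \<open>The formula for words persists for the empty word, where it reads \<Delta>(1) =
    1 \<otimes> 1. So the total marking, whose remaining word is empty, needs no separate
    treatment.\<close>
  have dp: "\<Delta> (basis (phrase_of v)) = (\<Sum>d\<in>markings L v. basis (cut_blocks d, phrase_of (cut_rest d)))"
    if "v \<in> lists A" for v
  proof (cases "v = []")
    case True
    have "markings L [] = {[]}" by (auto simp: markings_def admissible_def)
    moreover have "phrase_markings L [] = {[]}" by (auto simp: phrase_markings_def)
    ultimately show ?thesis
      using cut_comultiplication_phrase[OF \<Delta>, of "[]"] True
      by (simp add: phrase_of_def phrases_def phrase_term_def cut_blocks_def cut_rest_def)
  next
    case False
    then show ?thesis
      using \<Delta> that by (simp add: cut_comultiplication_def cut_coproduct_markings words_def phrase_of_def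
        del: in_lists_conv_set)
  qed
  let ?F = "\<lambda>l m r. basis (l, m, phrase_of r) :: _ \<Rightarrow>\<^sub>0 'r"
  have fst_in: "map fst b \<in> lists A" if "b \<in> markings L w" for b
    using that w' by (simp add: markings_def del: in_lists_conv_set)
  have "tensor_assoc (tensor_map \<Delta> id (\<Delta> (basis [w]))) =
    (\<Sum>b\<in>markings L w. tensor_assoc (tensor (\<Delta> (basis (cut_blocks b))) (basis (phrase_of (cut_rest b)))))"
    by (simp add: dw tensor_assoc_def tensor_map_def lin_ext_sum)
  also have "\<dots> = (\<Sum>b\<in>markings L w. \<Sum>X\<in>phrase_markings L (cut_blocks b).
      ?F (concat (map cut_blocks X)) (concat (map (\<lambda>b. phrase_of (cut_rest b)) X)) (cut_rest b))"
    by (rule sum.cong[OF refl])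
      (simp add: cut_comultiplication_phrase[OF \<Delta> cut_blocks_in[OF fst_in]] tensor_basis_right
        tensor_assoc_def lin_ext_lin_ext lin_ext_sum phrase_term_def)
  also have "\<dots> = (\<Sum>c\<in>markings L w. \<Sum>d\<in>markings L (cut_rest c).
      ?F (cut_blocks c) (cut_blocks d) (cut_rest d))"
    by (rule sum_double_markings[OF assms(1) w'(1)])
  also have "\<dots> = (\<Sum>c\<in>markings L w. tensor (basis (cut_blocks c)) (\<Delta> (basis (phrase_of (cut_rest c)))))"
    by (rule sum.cong[OF refl])
      (simp add: dp[OF cut_rest_in[OF fst_in]] tensor_basis_left lin_ext_sum)
  also have "\<dots> = tensor_map id \<Delta> (\<Delta> (basis [w]))"
    by (simp add: dw tensor_map_def lin_ext_sum)
  finally show ?thesis .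
qed

text \<open>Both sides are multiplicative with respect to concatenation in the three tensor factors.
  They agree on words, hence on phrases by induction, and then everywhere by linearity.\<close>

lemma cut_comultiplication_coassociative:
  fixes \<Delta> :: "('a list list \<Rightarrow>\<^sub>0 'r::{comm_ring,comm_monoid_mult}) \<Rightarrow> _"
  assumes "stable A L" and \<Delta>: "cut_comultiplication A L \<Delta>"
  shows "coassociative (phrases A) \<Delta>"
proof -
  let ?B = "phrases A"
  \<comment> \<open>\<open>?m2\<close> and \<open>?m3\<close> are the products on the bases of the
    double and the triple tensor product; \<open>?l\<close> and \<open>?r\<close> are the
    rebracketed \<Delta> \<otimes> id and id \<otimes> \<Delta> on basis pairs.\<close>
  let ?m2 = "\<lambda>z z'. (fst z @ fst z', snd z @ snd z')"
  let ?m3 = "\<lambda>(x, y, z) (x', y', z'). basis (x @ x', y @ y', z @ z') :: _ \<Rightarrow>\<^sub>0 'r"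
  let ?l = "\<lambda>z. lin_ext scale (\<lambda>u. basis (fst u, snd u, snd z)) (\<Delta> (basis (fst z)))"
  let ?r = "\<lambda>z. lin_ext scale (\<lambda>u. basis (fst z, u)) (\<Delta> (basis (snd z)))"
  have linear: "linear_on (free_module ?B) scale (free_module (?B \<times> ?B)) scale \<Delta>"
    and mult: "\<And>p q. p \<in> free_module ?B \<Longrightarrow> q \<in> free_module ?B \<Longrightarrow>
      \<Delta> (phrase_mult p q) = tensor_mult phrase_mult (\<Delta> p) (\<Delta> q)"
    using \<Delta> by (simp_all add: cut_comultiplication_def tensor_algebra_hom_def algebra_hom_def)
  have append_in: "x @ y \<in> ?B" if "x \<in> ?B" "y \<in> ?B" for x y
    using that by (simp add: phrases_def)
  have D_in: "\<Delta> (basis x) \<in> free_module UNIV" for x by simp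
  have D_append: "\<Delta> (basis (x @ y)) = bilin_ext (\<lambda>z z'. basis (?m2 z z')) (\<Delta> (basis x)) (\<Delta> (basis y))"
    if "x \<in> ?B" "y \<in> ?B" for x y
    using mult[of "basis x" "basis y"] that
    by (simp add: free_module_basis phrase_mult_def tensor_mult_phrase_mult[unfolded phrase_mult_def])
  have left: "tensor_assoc (tensor_map \<Delta> id u) = lin_ext scale ?l u" for u
    by (simp add: tensor_assoc_def tensor_map_def tensor_basis_right lin_ext_lin_ext case_prod_unfold)
  have right: "tensor_map id \<Delta> u = lin_ext scale ?r u" for u
    by (simp add: tensor_map_def tensor_basis_left lin_ext_lin_ext case_prod_unfold)
  have l_mult: "?l (?m2 z z') = bilin_ext ?m3 (?l z) (?l z')" if "z \<in> ?B \<times> ?B" "z' \<in> ?B \<times> ?B" for z z'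
  proof -
    have "fst z \<in> ?B" "fst z' \<in> ?B" using that by auto
    then have "?l (?m2 z z') = lin_ext scale (\<lambda>u. basis (fst u, snd u, snd z @ snd z'))
        (bilin_ext (\<lambda>z z'. basis (?m2 z z')) (\<Delta> (basis (fst z))) (\<Delta> (basis (fst z'))))"
      by (simp add: D_append)
    also have "\<dots> = bilin_ext ?m3 (?l z) (?l z')"
      by (rule bilin_ext_hom[OF _ D_in D_in]) simp
    finally show ?thesis .
  qed
  have r_mult: "?r (?m2 z z') = bilin_ext ?m3 (?r z) (?r z')" if "z \<in> ?B \<times> ?B" "z' \<in> ?B \<times> ?B" for z z'
  proof -
    have "snd z \<in> ?B" "snd z' \<in> ?B" using that by auto
    then have "?r (?m2 z z') = lin_ext scale (\<lambda>u. basis (fst z @ fst z', u))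
        (bilin_ext (\<lambda>z z'. basis (?m2 z z')) (\<Delta> (basis (snd z))) (\<Delta> (basis (snd z'))))"
      by (simp add: D_append)
    also have "\<dots> = bilin_ext ?m3 (?r z) (?r z')"
      by (rule bilin_ext_hom[OF _ D_in D_in]) (simp add: case_prod_unfold)
    finally show ?thesis .
  qed
  have l_hom: "lin_ext scale ?l (bilin_ext (\<lambda>z z'. basis (?m2 z z')) p q) =
      bilin_ext ?m3 (lin_ext scale ?l p) (lin_ext scale ?l q)"
    if "p \<in> free_module (?B \<times> ?B)" "q \<in> free_module (?B \<times> ?B)" for p q
    by (rule bilin_ext_hom[OF _ that]) (rule l_mult)
  have r_hom: "lin_ext scale ?r (bilin_ext (\<lambda>z z'. basis (?m2 z z')) p q) =
      bilin_ext ?m3 (lin_ext scale ?r p) (lin_ext scale ?r q)"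
    if "p \<in> free_module (?B \<times> ?B)" "q \<in> free_module (?B \<times> ?B)" for p q
    by (rule bilin_ext_hom[OF _ that]) (rule r_mult)
  have basis: "lin_ext scale ?l (\<Delta> (basis x)) = lin_ext scale ?r (\<Delta> (basis x))" if "x \<in> ?B" for x
    using that
  proof (induction x)
    case Nil
    have "\<Delta> (basis []) = basis ([], [])"
      using \<Delta> by (simp add: cut_comultiplication_def tensor_algebra_hom_def algebra_hom_def phrase_one_def)
    then show ?case by simp
  next
    case (Cons w x)
    then have w: "w \<in> words A" "[w] \<in> ?B" and x: "x \<in> ?B" by (auto simp: phrases_def)
    have D: "\<Delta> (basis [w]) \<in> free_module (?B \<times> ?B)" "\<Delta> (basis x) \<in> free_module (?B \<times> ?B)"
      using linear w x by (simp_all add: linear_on_def free_module_basis)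
    have "lin_ext scale ?l (\<Delta> (basis (w # x))) =
        bilin_ext ?m3 (lin_ext scale ?l (\<Delta> (basis [w]))) (lin_ext scale ?l (\<Delta> (basis x)))"
      using D_append[OF w(2) x] l_hom[OF D] by simp
    also have "\<dots> = bilin_ext ?m3 (lin_ext scale ?r (\<Delta> (basis [w]))) (lin_ext scale ?r (\<Delta> (basis x)))"
      using coassociative_words[OF assms w(1)] Cons.IH[OF x] by (simp only: left right)
    also have "\<dots> = lin_ext scale ?r (\<Delta> (basis (w # x)))"
      using D_append[OF w(2) x] r_hom[OF D] by simp
    finally show ?case .
  qed
  show ?thesis
    unfolding coassociative_def left right
    using linear_on_eqI[OF linear_on_lin_ext_comp[OF linear] linear_on_lin_ext_comp[OF linear] basis]
    by blast
qed

section \<open>The counit\<close>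

lemma phrase_counit:
  fixes \<Delta> :: "('a list list \<Rightarrow>\<^sub>0 'r::{comm_ring,comm_monoid_mult}) \<Rightarrow> _"
  assumes \<Delta>: "cut_comultiplication A L \<Delta>"
  shows "is_counit (phrases A) phrase_mult phrase_one \<Delta> (\<lambda>p. Poly_Mapping.lookup p [])"
proof -
  let ?B = "phrases A" and ?\<epsilon> = "\<lambda>p :: 'a list list \<Rightarrow>\<^sub>0 'r. Poly_Mapping.lookup p []"
  have eps_basis: "?\<epsilon> (basis x) = (if x = [] then 1 else 0)" for x
    by (simp add: basis_def lookup_single when_def)
  have linear: "linear_on (free_module ?B) scale (free_module (?B \<times> ?B)) scale \<Delta>"
    using \<Delta> by (simp_all add: cut_comultiplication_def tensor_algebra_hom_def algebra_hom_def)
  \<comment> \<open>On basis elements: a concatenation is empty exactly when both phrases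
    are.\<close>
  have mult: "?\<epsilon> (phrase_mult p q) = ?\<epsilon> p * ?\<epsilon> q" for p q
  proof (rule linear_on_eqI[where B = UNIV and f = "\<lambda>p. ?\<epsilon> (phrase_mult p q)" and s = "(*)"])
    show "linear_on (free_module UNIV) scale UNIV (*) (\<lambda>p. ?\<epsilon> (phrase_mult p q))"
      "linear_on (free_module UNIV) scale UNIV (*) (\<lambda>p. ?\<epsilon> p * ?\<epsilon> q)"
      by (auto simp: linear_on_def phrase_mult_def bilin_ext_simps lookup_add algebra_simps)
    fix x
    show "?\<epsilon> (phrase_mult (basis x) q) = ?\<epsilon> (basis x) * ?\<epsilon> q"
    proof (rule linear_on_eqI[where B = UNIV and f = "\<lambda>q. ?\<epsilon> (phrase_mult (basis x) q)" and s = "(*)"])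
      show "linear_on (free_module UNIV) scale UNIV (*) (\<lambda>q. ?\<epsilon> (phrase_mult (basis x) q))"
        "linear_on (free_module UNIV) scale UNIV (*) (\<lambda>q. ?\<epsilon> (basis x) * ?\<epsilon> q)"
        by (auto simp: linear_on_def phrase_mult_def bilin_ext_simps lookup_add algebra_simps)
      show "?\<epsilon> (phrase_mult (basis x) (basis y)) = ?\<epsilon> (basis x) * ?\<epsilon> (basis y)" for y
        by (simp add: phrase_mult_def eps_basis)
    qed simp
  qed simp
  have lin_id: "linear_on (free_module ?B) scale UNIV scale (\<lambda>p. p)"
    by (simp add: linear_on_def)
  show ?thesis
    unfolding is_counit_def
  proof (intro conjI ballI)
    show "linear_on (free_module ?B) scale UNIV (*) ?\<epsilon>"
      by (simp add: linear_on_def lookup_add)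
    show "?\<epsilon> phrase_one = 1" by (simp add: phrase_one_def eps_basis)
    fix p :: "'a list list \<Rightarrow>\<^sub>0 'r" assume p: "p \<in> free_module ?B"
    show "lin_ext scale (\<lambda>(x, y). scale (?\<epsilon> (basis x)) (basis y)) (\<Delta> p) = p"
    proof (rule linear_on_eqI[OF linear_on_lin_ext_comp[OF linear] lin_id _ p])
      fix x assume x: "x \<in> ?B"
      let ?X = "map (map (\<lambda>a. (a, False))) x"
      \<comment> \<open>Only the choice \<open>?X\<close> has an empty left phrase, and its term is
        \<open>([], x)\<close>.\<close>
      have "lin_ext scale (\<lambda>(x, y). scale (?\<epsilon> (basis x)) (basis y)) (\<Delta> (basis x)) =
          (\<Sum>X\<in>phrase_markings L x. if X = ?X then basis x else 0)"
        unfolding cut_comultiplication_phrase[OF \<Delta> x] lin_ext_sum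
      proof (rule sum.cong[OF refl])
        fix X assume X: "X \<in> phrase_markings L x"
        then have "fst (phrase_term X) = [] \<longleftrightarrow> X = ?X"
          by (subst fst_phrase_term_eq_Nil) (simp add: phrase_markings_def)
        then show "lin_ext scale (\<lambda>(x, y). scale (?\<epsilon> (basis x)) (basis y)) (basis (phrase_term X)) =
            (if X = ?X then basis x else 0)"
          using phrase_term_unmarked[OF nil_notin_phrase[OF x]] by (simp add: case_prod_unfold eps_basis)
      qed
      then show "lin_ext scale (\<lambda>(x, y). scale (?\<epsilon> (basis x)) (basis y)) (\<Delta> (basis x)) = basis x"
        using monochrome_markings[of False x L] by simp
    qed
    show "lin_ext scale (\<lambda>(x, y). scale (?\<epsilon> (basis y)) (basis x)) (\<Delta> p) = p"
    proof (rule linear_on_eqI[OF linear_on_lin_ext_comp[OF linear] lin_id _ p])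
      fix x assume x: "x \<in> ?B"
      let ?X = "map (map (\<lambda>a. (a, True))) x"
      have "lin_ext scale (\<lambda>(x, y). scale (?\<epsilon> (basis y)) (basis x)) (\<Delta> (basis x)) =
          (\<Sum>X\<in>phrase_markings L x. if X = ?X then basis x else 0)"
        unfolding cut_comultiplication_phrase[OF \<Delta> x] lin_ext_sum
      proof (rule sum.cong[OF refl])
        fix X assume X: "X \<in> phrase_markings L x"
        then have "snd (phrase_term X) = [] \<longleftrightarrow> X = ?X"
          by (subst snd_phrase_term_eq_Nil) (simp add: phrase_markings_def)
        then show "lin_ext scale (\<lambda>(x, y). scale (?\<epsilon> (basis y)) (basis x)) (basis (phrase_term X)) =
            (if X = ?X then basis x else 0)"
          using phrase_term_marked[OF nil_notin_phrase[OF x]] by (simp add: case_prod_unfold eps_basis)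
      qed
      then show "lin_ext scale (\<lambda>(x, y). scale (?\<epsilon> (basis y)) (basis x)) (\<Delta> (basis x)) = basis x"
        using monochrome_markings[of True x L] by simp
    qed
  qed (rule mult)
qed

theorem corollary4p2p2:
  fixes A :: "'a set"
    and L :: "'a list set"
    and \<Delta> :: "('a list list \<Rightarrow>\<^sub>0 'r::{comm_ring,comm_monoid_mult}) \<Rightarrow>
                ('a list list \<times> 'a list list \<Rightarrow>\<^sub>0 'r)"
  assumes "stable A L"
    and "cut_comultiplication A L \<Delta>"
  shows "hopf_algebra (phrases A) phrase_mult phrase_one \<Delta>"
proof -
  let ?B = "phrases A" and ?\<epsilon> = "\<lambda>p :: 'a list list \<Rightarrow>\<^sub>0 'r. Poly_Mapping.lookup p []"
  have hom: "tensor_algebra_hom ?B phrase_mult phrase_one \<Delta>"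
    using assms(2) by (simp add: cut_comultiplication_def)
  interpret free_coalgebra ?B phrase_mult phrase_one \<Delta>
    using hom cut_comultiplication_coassociative[OF assms]
    by unfold_locales (simp_all add: unital_algebra_phrases tensor_algebra_hom_def algebra_hom_def)
  have counit: "is_counit ?B phrase_mult phrase_one \<Delta> ?\<epsilon>"
    by (rule phrase_counit[OF assms(2)])
  moreover have "\<exists>S. is_antipode ?B phrase_mult phrase_one \<Delta> ?\<epsilon> S"
  proof (rule graded_antipode[OF counit, where e = "[]" and deg = "\<lambda>x. length (concat x)"])
    fix x assume x: "x \<in> ?B"
    show "?\<epsilon> (basis x) = (if x = [] then 1 else 0)"
      by (simp add: basis_def lookup_single when_def)
    \<comment> \<open>The words of a phrase are non-empty, so a phrase without letters has no
      words.\<close>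
    show "x = []" if "length (concat x) = 0"
      using that nil_notin_phrase[OF x] by (cases x) auto
    have "phrase_term X \<in> {(y, z). y \<in> ?B \<and> z \<in> ?B \<and>
        length (concat y) + length (concat z) = length (concat x)}"
      if X: "X \<in> phrase_markings L x" for X
    proof -
      have "x = map (map fst) X" using X by (simp add: phrase_markings_def)
      then have "length (concat X) = length (concat x)" by (simp flip: map_concat)
      then show ?thesis
        using phrase_term_in[OF X x] length_phrase_term[of X] by (simp add: case_prod_unfold)
    qed
    then show "\<Delta> (basis x) \<in> free_module {(y, z). y \<in> ?B \<and> z \<in> ?B \<and>
        length (concat y) + length (concat z) = length (concat x)}"
      unfolding cut_comultiplication_phrase[OF assms(2) x]
      by (intro free_module_sum free_module_basis)
  qed (simp add: phrase_one_def)
  ultimately show ?thesis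
    using hom cut_comultiplication_coassociative[OF assms]
    by (auto simp: hopf_algebra_def bialgebra_def unital_algebra_phrases)
qed

end
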